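(* Let $G$ be a $2$-tree-connected graph and let $f$ be a positive integer-valued function on $V(G)$. If for every $S\subseteq V(G)$, $$\tfrac{1}{2}\Omega_2(G\setminus S)\le \sum_{v\in S}\big(f(v)-\tfrac{3}{2}\big)+2,$$ then $G$ has a spanning closed trail meeting each vertex $v$ at most $f(v)$ times.
   Context: Graphs are finite, loopless, and may have multiple edges. A graph is $m$-tree-connected if it contains $m$ pairwise edge-disjoint spanning trees (a one-vertex graph is $m$-tree-connected). The $m$-tree-connected components of $G$ are its maximal induced $m$-tree-connected subgraphs; their vertex sets partition $V(G)$. For a partition $P$ of $V(G)$, $e_G(P)$ is the number of edges with ends in different parts. $\Omega_m(G)=m|P|-e_G(P)$ for $P$ the partition into vertex sets of the $m$-tree-connected components (and $\Omega_m=0$ for the graph with no vertices). $G\setminus S$ is obtained by deleting the vertices in $S$. A spanning closed trail meeting each vertex $v$ at most $f(v)$ times is a closed trail (no repeated edges) passing through every vertex and passing through each vertex $v$ at most $f(v)$ times. *)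

theory Defs
  imports Complex_Main
begin

record ('v, 'e) multigraph =
  verts :: "'v set"
  edges :: "'e set"
  ends :: "'e \<Rightarrow> 'v set"

text \<open>Finite loopless multigraphs; distinct edges may have the same set of ends.\<close>

definition fin_multigraph :: "('v, 'e) multigraph \<Rightarrow> bool" where
  "fin_multigraph G \<longleftrightarrow> finite (verts G) \<and> finite (edges G) \<and>
     (\<forall>e\<in>edges G. ends G e \<subseteq> verts G \<and> card (ends G e) = 2)"

definition induced :: "('v, 'e) multigraph \<Rightarrow> 'v set \<Rightarrow> ('v, 'e) multigraph" where
  "induced G X = G\<lparr>verts := X, edges := {e \<in> edges G. ends G e \<subseteq> X}\<rparr>"

definition del_verts :: "('v, 'e) multigraph \<Rightarrow> 'v set \<Rightarrow> ('v, 'e) multigraph" where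
  "del_verts G S = induced G (verts G - S)"

text \<open>A walk with \<open>k\<close> edges is given by its list of \<open>k + 1\<close> vertices and its list of \<open>k\<close> edges.\<close>

definition walk :: "('v, 'e) multigraph \<Rightarrow> 'v list \<Rightarrow> 'e list \<Rightarrow> bool" where
  "walk G vs es \<longleftrightarrow> length vs = Suc (length es) \<and> set vs \<subseteq> verts G \<and> set es \<subseteq> edges G \<and>
     (\<forall>i<length es. ends G (es ! i) = {vs ! i, vs ! Suc i})"

definition closed_trail :: "('v, 'e) multigraph \<Rightarrow> 'v list \<Rightarrow> 'e list \<Rightarrow> bool" where
  "closed_trail G vs es \<longleftrightarrow> walk G vs es \<and> distinct es \<and> hd vs = last vs"

text \<open>In a closed trail with at least one edge the first and the last entry of the vertex list
  are the same visit, which must be counted once. The trivial closed trail \<open>[v]\<close> (the one needed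
  for a one-vertex graph) meets \<open>v\<close> once.\<close>

definition visits :: "'v list \<Rightarrow> 'v \<Rightarrow> nat" where
  "visits vs v = (if length vs = 1 then count_list vs v else count_list (tl vs) v)"

text \<open>Two parallel edges form a cycle of length 2.\<close>

definition cycle :: "('v, 'e) multigraph \<Rightarrow> 'v list \<Rightarrow> 'e list \<Rightarrow> bool" where
  "cycle G vs es \<longleftrightarrow> closed_trail G vs es \<and> es \<noteq> [] \<and> distinct (tl vs)"

definition connected_graph :: "('v, 'e) multigraph \<Rightarrow> bool" where
  "connected_graph G \<longleftrightarrow> verts G \<noteq> {} \<and>
     (\<forall>u\<in>verts G. \<forall>v\<in>verts G. \<exists>vs es. walk G vs es \<and> hd vs = u \<and> last vs = v)"

definition tree :: "('v, 'e) multigraph \<Rightarrow> bool" where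
  "tree G \<longleftrightarrow> connected_graph G \<and> (\<nexists>vs es. cycle G vs es)"

definition spanning_tree :: "('v, 'e) multigraph \<Rightarrow> 'e set \<Rightarrow> bool" where
  "spanning_tree G F \<longleftrightarrow> F \<subseteq> edges G \<and> tree (G\<lparr>edges := F\<rparr>)"

text \<open>The trees form an indexed family rather than a set, so that in a one-vertex graph the
  edgeless spanning tree may be used \<open>m\<close> times.\<close>

definition tree_connected :: "nat \<Rightarrow> ('v, 'e) multigraph \<Rightarrow> bool" where
  "tree_connected m G \<longleftrightarrow>
     (\<exists>T :: nat \<Rightarrow> 'e set. (\<forall>i<m. spanning_tree G (T i)) \<and>
        (\<forall>i<m. \<forall>j<m. i \<noteq> j \<longrightarrow> T i \<inter> T j = {}))"

text \<open>Components are represented by their vertex sets; they are induced subgraphs, so maximality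
  amounts to maximality of the vertex set.\<close>

definition tree_components :: "nat \<Rightarrow> ('v, 'e) multigraph \<Rightarrow> 'v set set" where
  "tree_components m G = {X. X \<subseteq> verts G \<and> tree_connected m (induced G X) \<and>
     (\<forall>Y. X \<subset> Y \<and> Y \<subseteq> verts G \<longrightarrow> \<not> tree_connected m (induced G Y))}"

definition crossing_edges :: "('v, 'e) multigraph \<Rightarrow> 'v set set \<Rightarrow> 'e set" where
  "crossing_edges G P =
     {e \<in> edges G. \<exists>X\<in>P. \<exists>Y\<in>P. X \<noteq> Y \<and> ends G e \<inter> X \<noteq> {} \<and> ends G e \<inter> Y \<noteq> {}}"

text \<open>The convention that the graph without vertices has value 0 needs no separate clause: for
  \<open>m > 0\<close> it has no \<open>m\<close>-tree-connected component, because trees are nonempty.\<close>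

definition Omega :: "nat \<Rightarrow> ('v, 'e) multigraph \<Rightarrow> int" where
  "Omega m G = int m * int (card (tree_components m G))
     - int (card (crossing_edges G (tree_components m G)))"

end

theory Submission
  imports Defs
begin

text \<open>
  A union of two edge-disjoint spanning trees is the same as a \<^emph>\<open>base\<close>: an edge set with
  \<open>2|V| - 2\<close> elements of which at most \<open>2|X| - 2\<close> lie inside any nonempty \<open>X \<subseteq> V\<close>.
  Call \<open>X\<close> \<^emph>\<open>tight\<close> if equality holds. Tight sets that intersect are closed under union and
  intersection, and an edge \<open>xy\<close> outside a base can be exchanged for any base edge inside the
  smallest tight set containing \<open>x\<close> and \<open>y\<close>.

  Take a base \<open>F\<close> of least total excess over the bounds \<open>h(v) = 2 f(v) + 1\<close>. Following Ellingham
  and Zha's proof of Win's theorem, start from the set of vertices with excess and repeatedly add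
  the vertices whose degree cannot be pushed below \<open>h\<close> by changing \<open>F\<close> only inside their maximal tight
  set avoiding the vertices collected so far. If there is excess, this process ends with a
  nonempty \<open>S\<close> such that the maximal tight subsets of \<open>V - S\<close> are the 2-tree-connected components
  of \<open>G - S\<close> and every edge between them is in \<open>F\<close>; counting edges of \<open>F\<close> contradicts the hypothesis
  for \<open>S\<close>. So some base has all degrees at most \<open>2 f(v) + 1\<close>. Adding to one of its two trees
  a parity-correcting subset of the other gives a connected even spanning subgraph, and a longest
  trail in it is the required closed trail.
\<close>

section \<open>Sparse and tight edge sets\<close>

text \<open>The incidence map is an argument of its own, so that one edge name can be given new ends
  by a function update, and the same map can serve for many vertex sets and edge sets.\<close>

definition graph_on :: "('e \<Rightarrow> 'v set) \<Rightarrow> 'v set \<Rightarrow> 'e set \<Rightarrow> bool" where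
  "graph_on \<phi> V F \<longleftrightarrow> finite V \<and> finite F \<and> (\<forall>e\<in>F. \<phi> e \<subseteq> V \<and> card (\<phi> e) = 2)"

definition inside :: "('e \<Rightarrow> 'v set) \<Rightarrow> 'e set \<Rightarrow> 'v set \<Rightarrow> 'e set" where
  "inside \<phi> F X = {e \<in> F. \<phi> e \<subseteq> X}"

definition degree :: "('e \<Rightarrow> 'v set) \<Rightarrow> 'e set \<Rightarrow> 'v \<Rightarrow> nat" where
  "degree \<phi> F v = card {e \<in> F. v \<in> \<phi> e}"

text \<open>This is the Nash-Williams condition for a decomposition of \<open>F\<close> into
  \<open>m\<close> forests. It is written additively because subtraction on \<open>nat\<close>
  truncates.\<close>

definition sparse :: "nat \<Rightarrow> ('e \<Rightarrow> 'v set) \<Rightarrow> 'v set \<Rightarrow> 'e set \<Rightarrow> bool" where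
  "sparse m \<phi> V F \<longleftrightarrow>
     (\<forall>X\<subseteq>V. X \<noteq> {} \<longrightarrow> card (inside \<phi> F X) + m \<le> m * card X)"

text \<open>For \<open>m > 0\<close> the empty set is never tight, since the equation would read
  \<open>... + m = 0\<close>.\<close>

definition tight :: "nat \<Rightarrow> ('e \<Rightarrow> 'v set) \<Rightarrow> 'e set \<Rightarrow> 'v set \<Rightarrow> bool" where
  "tight m \<phi> F X \<longleftrightarrow> card (inside \<phi> F X) + m = m * card X"

definition base :: "nat \<Rightarrow> ('e \<Rightarrow> 'v set) \<Rightarrow> 'v set \<Rightarrow> 'e set \<Rightarrow> bool" where
  "base m \<phi> V F \<longleftrightarrow> graph_on \<phi> V F \<and> sparse m \<phi> V F \<and> tight m \<phi> F V"

text \<open>Only edges with both ends in \<open>C\<close> may change; an edge with a single end in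
  \<open>C\<close> is fixed like one that avoids \<open>C\<close>.\<close>

definition agree :: "('e \<Rightarrow> 'v set) \<Rightarrow> 'v set \<Rightarrow> 'e set \<Rightarrow> 'e set \<Rightarrow> bool" where
  "agree \<phi> C F F' \<longleftrightarrow> (\<forall>e. \<not> \<phi> e \<subseteq> C \<longrightarrow> (e \<in> F \<longleftrightarrow> e \<in> F'))"

lemma baseD:
  assumes "base m \<phi> V F"
  shows "graph_on \<phi> V F" "sparse m \<phi> V F" "tight m \<phi> F V" "finite F" "finite V"
    "\<And>e. e \<in> F \<Longrightarrow> \<phi> e \<subseteq> V" "\<And>e. e \<in> F \<Longrightarrow> card (\<phi> e) = 2"
  using assms by (auto simp: base_def graph_on_def)

lemma inside_all: "graph_on \<phi> V F \<Longrightarrow> inside \<phi> F V = F"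
  by (auto simp: graph_on_def inside_def)

lemma finite_inside: "finite F \<Longrightarrow> finite (inside \<phi> F X)"
  by (simp add: inside_def)

lemma inside_subset: "inside \<phi> F X \<subseteq> F"
  by (auto simp: inside_def)

lemma sparseD:
  "sparse m \<phi> V F \<Longrightarrow> X \<subseteq> V \<Longrightarrow> X \<noteq> {} \<Longrightarrow> card (inside \<phi> F X) + m \<le> m * card X"
  by (simp add: sparse_def)

lemma tight_singleton:
  assumes "graph_on \<phi> V F"
  shows "tight m \<phi> F {v}"
proof -
  have "card (\<phi> e) \<le> 1" if "\<phi> e \<subseteq> {v}" for e
    using card_mono[OF _ that] by simp
  then have "inside \<phi> F {v} = {}"
    using assms unfolding inside_def graph_on_def by fastforce
  then show ?thesis by (simp add: tight_def)
qed

lemma mult_card_Un_Int: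
  assumes "finite X" "finite Y"
  shows "m * card (X \<union> Y) + m * card (X \<inter> Y) = m * card X + m * card Y"
  using card_Un_Int[OF assms] by (metis distrib_left)

text \<open>An edge inside both sets is inside the intersection, and an edge inside either is inside
  the union. The union may contain further edges that run from one set to the other.\<close>

lemma card_inside_supermodular:
  assumes "finite F"
  shows "card (inside \<phi> F X) + card (inside \<phi> F Y)
    \<le> card (inside \<phi> F (X \<union> Y)) + card (inside \<phi> F (X \<inter> Y))"
proof -
  have "card (inside \<phi> F X) + card (inside \<phi> F Y)
      = card (inside \<phi> F X \<union> inside \<phi> F Y) + card (inside \<phi> F X \<inter> inside \<phi> F Y)"
    by (rule card_Un_Int) (use assms in \<open>auto intro: finite_inside\<close>)
  moreover have "inside \<phi> F X \<inter> inside \<phi> F Y = inside \<phi> F (X \<inter> Y)"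
    by (auto simp: inside_def)
  moreover have "card (inside \<phi> F X \<union> inside \<phi> F Y) \<le> card (inside \<phi> F (X \<union> Y))"
    by (rule card_mono) (use assms in \<open>auto simp: inside_def\<close>)
  ultimately show ?thesis by simp
qed

text \<open>Uncrossing: vertex counts are modular and edge counts supermodular, so the union and the
  intersection together carry at least the number of edges that sparsity allows them. Hence both
  bounds are attained. The sets must meet for sparsity to apply to the intersection.\<close>

lemma tight_Un_Int:
  assumes F: "graph_on \<phi> V F" "sparse m \<phi> V F"
    and X: "X \<subseteq> V" "tight m \<phi> F X" and Y: "Y \<subseteq> V" "tight m \<phi> F Y"
    and ne: "X \<inter> Y \<noteq> {}"
  shows "tight m \<phi> F (X \<union> Y)" "tight m \<phi> F (X \<inter> Y)"
proof -
  have fin: "finite X" "finite Y" "finite F"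
    using F(1) X(1) Y(1) by (auto simp: graph_on_def intro: finite_subset)
  have "card (inside \<phi> F (X \<union> Y)) + m \<le> m * card (X \<union> Y)"
    "card (inside \<phi> F (X \<inter> Y)) + m \<le> m * card (X \<inter> Y)"
    by (rule sparseD[OF F(2)]; use X Y ne in blast)+
  then show "tight m \<phi> F (X \<union> Y)" "tight m \<phi> F (X \<inter> Y)"
    using mult_card_Un_Int[OF fin(1,2), of m] card_inside_supermodular[OF fin(3), of \<phi> X Y] X(2) Y(2)
    unfolding tight_def by linarith+
qed

section \<open>Smallest and largest tight sets\<close>

text \<open>A candidate of least cardinality exists because \<open>V\<close> is one. Two candidates
  share \<open>x\<close>, so their intersection is again a candidate, and minimality makes the
  chosen one a subset of every other.\<close>

lemma minimal_tight:
  assumes F: "base m \<phi> V F" and xy: "x \<in> V" "y \<in> V"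
  obtains X where "X \<subseteq> V" "tight m \<phi> F X" "x \<in> X" "y \<in> X"
    "\<And>Y. Y \<subseteq> V \<Longrightarrow> tight m \<phi> F Y \<Longrightarrow> x \<in> Y \<Longrightarrow> y \<in> Y \<Longrightarrow> X \<subseteq> Y"
proof -
  let ?P = "\<lambda>X. X \<subseteq> V \<and> tight m \<phi> F X \<and> x \<in> X \<and> y \<in> X"
  have "?P V" using baseD(3)[OF F] xy by blast
  from ex_has_least_nat[where P = ?P and m = card, OF this]
  obtain X where X: "?P X" and min: "\<And>Y. ?P Y \<Longrightarrow> card X \<le> card Y"
    by (elim exE conjE) blast
  have sub: "X \<subseteq> Y" if Y: "?P Y" for Y
  proof -
    have "?P (X \<inter> Y)"
      using tight_Un_Int(2)[OF baseD(1,2)[OF F], of X Y] X Y by blast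
    then have "card X \<le> card (X \<inter> Y)" by (rule min)
    moreover have "finite X" using X baseD(5)[OF F] finite_subset by blast
    ultimately have "X \<inter> Y = X" by (intro card_seteq) auto
    then show ?thesis by blast
  qed
  show thesis by (rule that[of X]) (use X sub in simp_all)
qed

text \<open>Dual to \<open>minimal_tight\<close>: the singleton of \<open>u\<close> is a candidate,
  and candidates are closed under union because they share \<open>u\<close>.\<close>

lemma maximal_tight:
  assumes F: "graph_on \<phi> V F" "sparse m \<phi> V F" and u: "u \<in> W" "W \<subseteq> V"
  obtains X where "X \<subseteq> W" "tight m \<phi> F X" "u \<in> X"
    "\<And>Y. Y \<subseteq> W \<Longrightarrow> tight m \<phi> F Y \<Longrightarrow> u \<in> Y \<Longrightarrow> Y \<subseteq> X"
proof -
  let ?P = "\<lambda>X. X \<subseteq> W \<and> tight m \<phi> F X \<and> u \<in> X"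
  have finW: "finite W" using F(1) u(2) by (auto simp: graph_on_def intro: finite_subset)
  have "?P {u}" using tight_singleton[OF F(1)] u by blast
  moreover have "\<forall>X. ?P X \<longrightarrow> card X < Suc (card W)"
    using finW by (simp add: card_mono less_Suc_eq_le)
  ultimately have "\<exists>X. ?P X \<and> (\<forall>Y. ?P Y \<longrightarrow> card Y \<le> card X)"
    by (rule ex_has_greatest_nat[where P = ?P])
  then obtain X where X: "?P X" and max: "\<And>Y. ?P Y \<Longrightarrow> card Y \<le> card X"
    by (elim exE conjE) blast
  have sub: "Y \<subseteq> X" if Y: "?P Y" for Y
  proof -
    have "?P (X \<union> Y)"
      using tight_Un_Int(1)[OF F, of X Y] X Y u(2) by blast
    then have "card (X \<union> Y) \<le> card X" by (rule max)
    moreover have "finite (X \<union> Y)" using X Y finW finite_subset by blast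
    ultimately have "X = X \<union> Y" by (intro card_seteq) auto
    then show ?thesis by blast
  qed
  show thesis by (rule that[of X]) (use X sub in simp_all)
qed

text \<open>A union is total and monotone in \<open>W\<close> for trivial reasons; that it is itself
  tight follows from uncrossing. For \<open>u\<close> outside \<open>W\<close> it is empty.\<close>

definition tight_comp :: "nat \<Rightarrow> ('e \<Rightarrow> 'v set) \<Rightarrow> 'e set \<Rightarrow> 'v set \<Rightarrow> 'v \<Rightarrow> 'v set" where
  "tight_comp m \<phi> F W u = \<Union>{X. X \<subseteq> W \<and> u \<in> X \<and> tight m \<phi> F X}"

lemma tight_comp_maximal:
  "Y \<subseteq> W \<Longrightarrow> tight m \<phi> F Y \<Longrightarrow> u \<in> Y \<Longrightarrow> Y \<subseteq> tight_comp m \<phi> F W u"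
  by (auto simp: tight_comp_def)

lemma tight_comp_subset: "tight_comp m \<phi> F W u \<subseteq> W"
  by (auto simp: tight_comp_def)

lemma tight_comp_mono: "W \<subseteq> W' \<Longrightarrow> tight_comp m \<phi> F W u \<subseteq> tight_comp m \<phi> F W' u"
  unfolding tight_comp_def by (intro Union_mono Collect_mono impI) auto

lemma tight_comp:
  assumes F: "graph_on \<phi> V F" "sparse m \<phi> V F" and u: "u \<in> W" "W \<subseteq> V"
  shows "tight m \<phi> F (tight_comp m \<phi> F W u)" "u \<in> tight_comp m \<phi> F W u"
proof -
  obtain X where "X \<subseteq> W" "tight m \<phi> F X" "u \<in> X"
    "\<And>Y. Y \<subseteq> W \<Longrightarrow> tight m \<phi> F Y \<Longrightarrow> u \<in> Y \<Longrightarrow> Y \<subseteq> X"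
    by (rule maximal_tight[OF F u]) blast
  then have "tight_comp m \<phi> F W u = X"
    unfolding tight_comp_def by (intro equalityI Union_least Union_upper) auto
  then show "tight m \<phi> F (tight_comp m \<phi> F W u)" "u \<in> tight_comp m \<phi> F W u"
    using \<open>tight m \<phi> F X\<close> \<open>u \<in> X\<close> by auto
qed

text \<open>Each of the two tight sets turns out to contain the vertex defining the other, so
  maximality gives both inclusions. Hence the sets \<open>tight_comp\<close> partition
  \<open>W\<close>.\<close>

lemma tight_comp_eq:
  assumes F: "graph_on \<phi> V F" "sparse m \<phi> V F" and W: "W \<subseteq> V"
    and u: "u \<in> W" and w: "w \<in> tight_comp m \<phi> F W u"
  shows "tight_comp m \<phi> F W w = tight_comp m \<phi> F W u"
proof
  have wW: "w \<in> W" using w tight_comp_subset[of m \<phi> F W u] by (rule rev_subsetD)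
  note tu = tight_comp[OF F u W] and tw = tight_comp[OF F wW W]
  show *: "tight_comp m \<phi> F W u \<subseteq> tight_comp m \<phi> F W w"
    by (intro tight_comp_maximal tight_comp_subset tu w)
  show "tight_comp m \<phi> F W w \<subseteq> tight_comp m \<phi> F W u"
    by (intro tight_comp_maximal tight_comp_subset tw) (use * tu in blast)
qed

text \<open>Deleting \<open>z\<close> lowers the bound by \<open>m > 0\<close>. If no edge inside
  \<open>X\<close> met \<open>z\<close>, the edges inside \<open>X\<close> would exceed the bound
  for \<open>X - {z}\<close>.\<close>

lemma tight_vertex_edge:
  assumes F: "graph_on \<phi> V F" "sparse m \<phi> V F" "m > 0"
    and X: "X \<subseteq> V" "tight m \<phi> F X" "z \<in> X" "X \<noteq> {z}"
  obtains g where "g \<in> inside \<phi> F X" "z \<in> \<phi> g"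
proof -
  have fin: "finite X" "finite F" using F(1) X(1) by (auto simp: graph_on_def intro: finite_subset)
  have "card (inside \<phi> F (X - {z})) + m \<le> m * card (X - {z})"
    by (rule sparseD[OF F(2)]) (use X in auto)
  also have "\<dots> < m * card X"
    using F(3) X(3) fin(1) by (metis card_Diff1_less mult_less_mono2)
  finally have "card (inside \<phi> F (X - {z})) < card (inside \<phi> F X)"
    using X(2) by (simp add: tight_def)
  then have "\<not> inside \<phi> F X \<subseteq> inside \<phi> F (X - {z})"
    using card_mono[OF finite_inside[OF fin(2)]] by (meson not_less)
  then show thesis using that by (auto simp: inside_def)
qed

section \<open>Exchange and replacement in bases\<close>

text \<open>Adding \<open>e\<close> can violate the bound only on a tight set containing both its
  ends. Every such set contains \<open>X\<close>, so it also loses \<open>g\<close> and its count is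
  unchanged. A set that is not tight has room for one more edge.\<close>

lemma base_exchange:
  assumes F: "base m \<phi> V F" and e: "e \<notin> F" "\<phi> e = {x, y}" "x \<noteq> y" "x \<in> V" "y \<in> V"
    and min: "\<And>Y. Y \<subseteq> V \<Longrightarrow> tight m \<phi> F Y \<Longrightarrow> x \<in> Y \<Longrightarrow> y \<in> Y \<Longrightarrow> X \<subseteq> Y"
    and g: "g \<in> inside \<phi> F X"
  shows "base m \<phi> V (insert e (F - {g}))"
proof -
  note fin = baseD(4)[OF F]
  have F_graph: "g \<in> F" using g by (auto simp: inside_def)
  have gr: "graph_on \<phi> V (insert e (F - {g}))"
    using baseD(1)[OF F] e by (auto simp: graph_on_def)
  have "card (inside \<phi> (insert e (F - {g})) Z) + m \<le> m * card Z" if Z: "Z \<subseteq> V" "Z \<noteq> {}" for Z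
  proof -
    have le: "card (inside \<phi> F Z) + m \<le> m * card Z"
      using sparseD[OF baseD(2)[OF F] Z] .
    have finI: "finite (inside \<phi> F Z)" using fin by (rule finite_inside)
    consider "\<not> \<phi> e \<subseteq> Z" | "\<phi> e \<subseteq> Z" "tight m \<phi> F Z" | "\<phi> e \<subseteq> Z" "\<not> tight m \<phi> F Z"
      by blast
    then show ?thesis
    proof cases
      case 1
      then have "inside \<phi> (insert e (F - {g})) Z \<subseteq> inside \<phi> F Z" by (auto simp: inside_def)
      then show ?thesis using card_mono[OF finI, of "inside \<phi> (insert e (F - {g})) Z"] le by linarith
    next
      case 2
      then have "X \<subseteq> Z" using min Z e by auto
      then have gZ: "g \<in> inside \<phi> F Z" using g by (auto simp: inside_def)
      have "inside \<phi> (insert e (F - {g})) Z = insert e (inside \<phi> F Z - {g})"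
        using 2 by (auto simp: inside_def)
      also have "card \<dots> = card (inside \<phi> F Z)"
        using card_Suc_Diff1[OF finI gZ] e(1) finI by (simp add: inside_def)
      finally show ?thesis using le by simp
    next
      case 3
      have "inside \<phi> (insert e (F - {g})) Z \<subseteq> insert e (inside \<phi> F Z)"
        by (auto simp: inside_def)
      then have "card (inside \<phi> (insert e (F - {g})) Z) \<le> card (insert e (inside \<phi> F Z))"
        using finI by (intro card_mono) auto
      also have "\<dots> \<le> card (inside \<phi> F Z) + 1"
        using finI by (simp add: card_insert_if)
      finally show ?thesis using le 3(2) by (simp add: tight_def)
    qed
  qed
  moreover have "card (insert e (F - {g})) = card F"
    using card_Suc_Diff1[OF fin F_graph] e(1) fin by simp
  ultimately show ?thesis
    using gr baseD(1,3)[OF F] unfolding base_def sparse_def tight_def by (simp add: inside_all)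
qed

text \<open>What a base has inside a tight set can be exchanged for what another base has there. For
  \<open>Z\<close> meeting \<open>C\<close>, the bound follows from the one for \<open>F\<close> on
  \<open>Z \<union> C\<close>, the one for \<open>B\<close> on \<open>Z \<inter> C\<close>, and the
  tightness of \<open>C\<close>.\<close>

lemma base_replace:
  assumes F: "base m \<phi> V F" and C: "C \<subseteq> V" "tight m \<phi> F C"
    and B: "base m \<phi> V B" "tight m \<phi> B C"
  shows "base m \<phi> V ((F - inside \<phi> F C) \<union> inside \<phi> B C)"
proof -
  define H where "H = (F - inside \<phi> F C) \<union> inside \<phi> B C"
  note fin = baseD(4)[OF F] baseD(4)[OF B(1)]
  have finV: "finite V" using baseD(5)[OF F] .
  have count: "card (inside \<phi> H Z) + card (inside \<phi> F (Z \<inter> C))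
      = card (inside \<phi> B (Z \<inter> C)) + card (inside \<phi> F Z)" for Z
  proof -
    have eq: "inside \<phi> H Z = inside \<phi> B (Z \<inter> C) \<union> (inside \<phi> F Z - inside \<phi> F (Z \<inter> C))"
      by (auto simp: H_def inside_def)
    have "card (inside \<phi> H Z)
        = card (inside \<phi> B (Z \<inter> C)) + card (inside \<phi> F Z - inside \<phi> F (Z \<inter> C))"
      unfolding eq by (rule card_Un_disjoint) (use fin in \<open>auto simp: inside_def\<close>)
    moreover have sub: "inside \<phi> F (Z \<inter> C) \<subseteq> inside \<phi> F Z"
      by (auto simp: inside_def)
    ultimately show ?thesis
      using card_Diff_subset[OF finite_inside[OF fin(1)] sub]
        card_mono[OF finite_inside[OF fin(1)] sub] by linarith
  qed
  have gr: "graph_on \<phi> V H"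
    using baseD(1)[OF F] baseD(1)[OF B(1)] by (auto simp: graph_on_def H_def inside_def)
  have "card (inside \<phi> H Z) + m \<le> m * card Z" if Z: "Z \<subseteq> V" "Z \<noteq> {}" for Z
  proof (cases "Z \<inter> C = {}")
    case True
    \<comment> \<open>Edges have nonempty sets of ends, so when \<open>Z\<close> misses
      \<open>C\<close> both correction terms in \<open>count\<close> vanish.\<close>
    have "card (inside \<phi> D {}) = 0" if "base m \<phi> V D" for D
    proof -
      have "\<phi> e \<noteq> {}" if "e \<in> D" for e
        using baseD(7)[OF \<open>base m \<phi> V D\<close> that] by auto
      then have "inside \<phi> D {} = {}" by (auto simp: inside_def)
      then show ?thesis by simp
    qed
    then show ?thesis
      using count[of Z] True F B(1) sparseD[OF baseD(2)[OF F] Z] by simp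
  next
    case False
    have "card (inside \<phi> F (Z \<union> C)) + m \<le> m * card (Z \<union> C)"
      by (rule sparseD[OF baseD(2)[OF F]]) (use Z C in auto)
    moreover have "card (inside \<phi> B (Z \<inter> C)) + m \<le> m * card (Z \<inter> C)"
      by (rule sparseD[OF baseD(2)[OF B(1)]]) (use Z C False in auto)
    moreover have "finite Z" "finite C" using Z C finV finite_subset by blast+
    ultimately show ?thesis
      using count[of Z] card_inside_supermodular[OF fin(1), of \<phi> Z C] C(2)
        mult_card_Un_Int[of Z C m] unfolding tight_def by linarith
  qed
  moreover have "tight m \<phi> H V"
    using count[of V] C B(2) baseD(3)[OF F] by (simp add: tight_def Int_absorb1)
  ultimately show ?thesis
    using gr by (simp add: base_def sparse_def H_def)
qed

text \<open>All bases on \<open>V\<close> have the same size, and the two bases have the same edges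
  not contained in \<open>X\<close>; so they have equally many inside \<open>X\<close>.\<close>

lemma agree_tight:
  assumes "base m \<phi> V F" "base m \<phi> V F'" "agree \<phi> C F F'" "C \<subseteq> X" "tight m \<phi> F X"
  shows "tight m \<phi> F' X"
proof -
  have split: "card D = card (inside \<phi> D X) + card {e \<in> D. \<not> \<phi> e \<subseteq> X}" if "finite D" for D
  proof -
    have "card (inside \<phi> D X \<union> {e \<in> D. \<not> \<phi> e \<subseteq> X})
        = card (inside \<phi> D X) + card {e \<in> D. \<not> \<phi> e \<subseteq> X}"
      by (rule card_Un_disjoint) (use that in \<open>auto simp: inside_def\<close>)
    moreover have "inside \<phi> D X \<union> {e \<in> D. \<not> \<phi> e \<subseteq> X} = D" by (auto simp: inside_def)
    ultimately show ?thesis by simp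
  qed
  have "{e \<in> F. \<not> \<phi> e \<subseteq> X} = {e \<in> F'. \<not> \<phi> e \<subseteq> X}"
    using assms(3,4) by (auto simp: agree_def)
  moreover have "card F = card F'"
    using baseD(1,3)[OF assms(1)] baseD(1,3)[OF assms(2)] by (simp add: tight_def inside_all)
  ultimately have "card (inside \<phi> F X) = card (inside \<phi> F' X)"
    using split[OF baseD(4)[OF assms(1)]] split[OF baseD(4)[OF assms(2)]] by simp
  then show ?thesis using assms(5) by (simp add: tight_def)
qed

lemma agree_degree: "agree \<phi> C F F' \<Longrightarrow> v \<notin> C \<Longrightarrow> degree \<phi> F' v = degree \<phi> F v"
  unfolding degree_def agree_def by (intro arg_cong[where f = card]) blast

lemma agree_sym: "agree \<phi> C F F' \<Longrightarrow> agree \<phi> C F' F"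
  by (auto simp: agree_def)

section \<open>Exchanging edges of a base\<close>

text \<open>The strict inequality at \<open>z\<close> leaves room for one more edge there, which an
  exchange will use up.\<close>

definition locally_improvable ::
  "nat \<Rightarrow> ('e \<Rightarrow> 'v set) \<Rightarrow> 'v set \<Rightarrow> 'e set \<Rightarrow> ('v \<Rightarrow> nat) \<Rightarrow> 'e set \<Rightarrow> 'v set \<Rightarrow> 'v \<Rightarrow> 'e set \<Rightarrow> bool" where
  "locally_improvable m \<phi> V E h F C z F' \<longleftrightarrow> F' \<subseteq> E \<and> base m \<phi> V F' \<and> agree \<phi> C F F' \<and>
     (\<forall>v\<in>C. degree \<phi> F' v \<le> h v) \<and> degree \<phi> F' z < h z"

text \<open>Changes inside two disjoint tight sets do not interfere: edges are nonempty, so none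
  lies in both sets, and the two changes can be carried out together.\<close>

lemma merge_bases:
  assumes F: "base m \<phi> V F"
    and B: "base m \<phi> V B" "agree \<phi> C F B" and D: "base m \<phi> V D" "agree \<phi> C' F D"
    and C: "C \<subseteq> V" "tight m \<phi> F C" and C': "C' \<subseteq> V" "tight m \<phi> F C'" and disj: "C \<inter> C' = {}"
  obtains F' where "base m \<phi> V F'" "F' \<subseteq> B \<union> D" "agree \<phi> (C \<union> C') F F'"
    "tight m \<phi> F' C" "tight m \<phi> F' C'"
    "\<And>e. \<not> \<phi> e \<subseteq> C \<Longrightarrow> \<not> \<phi> e \<subseteq> C' \<Longrightarrow> e \<in> F' \<longleftrightarrow> e \<in> F"
    "\<And>v. v \<notin> C' \<Longrightarrow> degree \<phi> F' v = degree \<phi> B v"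
    "\<And>v. v \<notin> C \<Longrightarrow> degree \<phi> F' v = degree \<phi> D v"
proof
  \<comment> \<open>Inside \<open>C'\<close> the base \<open>B\<close> still coincides with
    \<open>F\<close>, so \<open>C'\<close> is tight in \<open>B\<close> and its edges there may be
    replaced by those of \<open>D\<close>.\<close>
  define F' where "F' = (B - inside \<phi> B C') \<union> inside \<phi> D C'"
  have ne: "\<phi> e \<noteq> {}" if "e \<in> F \<union> B \<union> D" for e
    using that baseD(7)[OF F, of e] baseD(7)[OF B(1), of e] baseD(7)[OF D(1), of e] by force
  have "inside \<phi> B C' = inside \<phi> F C'"
  proof -
    have "\<not> \<phi> e \<subseteq> C" if "\<phi> e \<subseteq> C'" "e \<in> F \<union> B" for e
      using that disj ne[of e] by blast
    then show ?thesis using B(2) unfolding inside_def agree_def by blast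
  qed
  then have tB: "tight m \<phi> B C'" using C'(2) by (simp add: tight_def)
  have tD: "tight m \<phi> D C'"
    by (rule agree_tight[OF F D order_refl C'(2)])
  show "base m \<phi> V F'"
    unfolding F'_def by (rule base_replace[OF B(1) C'(1) tB D(1) tD])
  have "inside \<phi> F' C' = inside \<phi> D C'" by (auto simp: F'_def inside_def)
  then show "tight m \<phi> F' C'" using tD by (simp add: tight_def)
  have "\<not> \<phi> e \<subseteq> C'" if "\<phi> e \<subseteq> C" "e \<in> B \<union> D" for e
    using that disj ne[of e] by blast
  then have "inside \<phi> F' C = inside \<phi> B C"
    unfolding F'_def inside_def by blast
  then show "tight m \<phi> F' C"
    using agree_tight[OF F B order_refl C(2)] by (simp add: tight_def)
  show "F' \<subseteq> B \<union> D" by (auto simp: F'_def inside_def)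
  show *: "e \<in> F' \<longleftrightarrow> e \<in> F" if "\<not> \<phi> e \<subseteq> C" "\<not> \<phi> e \<subseteq> C'" for e
    using that B(2) by (auto simp: F'_def inside_def agree_def)
  show "agree \<phi> (C \<union> C') F F'"
    unfolding agree_def using * by blast
  show "degree \<phi> F' v = degree \<phi> B v" if "v \<notin> C'" for v
    unfolding degree_def F'_def inside_def using that by (intro arg_cong[where f = card]) blast
  show "degree \<phi> F' v = degree \<phi> D v" if v: "v \<notin> C" for v
  proof -
    \<comment> \<open>An edge at \<open>v\<close> is not inside \<open>C\<close>, so
      \<open>B\<close> has it exactly if \<open>F\<close> does; if it is not inside
      \<open>C'\<close> either, the same holds for \<open>D\<close>.\<close>
    have "e \<in> B \<longleftrightarrow> e \<in> D" if "v \<in> \<phi> e" "\<not> \<phi> e \<subseteq> C'" for e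
      using B(2) D(2) v that unfolding agree_def by blast
    then show ?thesis
      unfolding degree_def F'_def inside_def by (intro arg_cong[where f = card]) blast
  qed
qed

text \<open>First make room at \<open>x\<close> and \<open>y\<close> independently, then add
  \<open>e\<close>. The smallest tight set around \<open>e\<close> is forced to meet
  \<open>S\<close>, so an edge at some \<open>z\<close> in \<open>S\<close> can be given up for
  \<open>e\<close>. All changes stay inside the tight set \<open>W\<close>.\<close>

lemma augment:
  assumes m: "m > 0" and E: "graph_on \<phi> V E" and F: "base m \<phi> V F" "F \<subseteq> E"
    and S: "S \<subseteq> V" and e: "e \<in> E - F" "\<phi> e = {x, y}" "x \<in> V - S" "y \<in> V - S"
    and sep: "\<And>X. X \<subseteq> V - S \<Longrightarrow> tight m \<phi> F X \<Longrightarrow> x \<in> X \<Longrightarrow> y \<notin> X"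
    and B: "locally_improvable m \<phi> V E h F (tight_comp m \<phi> F (V - S) x) x B"
    and D: "locally_improvable m \<phi> V E h F (tight_comp m \<phi> F (V - S) y) y D"
    and W: "W \<subseteq> V" "tight m \<phi> F W"
      "tight_comp m \<phi> F (V - S) x \<subseteq> W" "tight_comp m \<phi> F (V - S) y \<subseteq> W"
  obtains F' z where "z \<in> S \<inter> W" "F' \<subseteq> E" "base m \<phi> V F'" "agree \<phi> W F F'"
    "degree \<phi> F' z < degree \<phi> F z" "\<And>v. degree \<phi> F' v \<le> max (h v) (degree \<phi> F v)"
proof -
  let ?C = "tight_comp m \<phi> F (V - S)"
  note F_graph = baseD(1,2)[OF F(1)]
  have xy: "x \<noteq> y" "x \<in> V" "y \<in> V"
    using E e by (auto simp: graph_on_def)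
  have sub: "?C u \<subseteq> V - S" for u by (rule tight_comp_subset)
  have tx: "tight m \<phi> F (?C x)" "x \<in> ?C x" and ty: "tight m \<phi> F (?C y)" "y \<in> ?C y"
    by (rule tight_comp[OF F_graph e(3) Diff_subset] tight_comp[OF F_graph e(4) Diff_subset])+
  \<comment> \<open>If they met, their union would be a tight set avoiding \<open>S\<close> that
    contains both \<open>x\<close> and \<open>y\<close>.\<close>
  have disj: "?C x \<inter> ?C y = {}"
  proof (rule ccontr)
    assume "?C x \<inter> ?C y \<noteq> {}"
    then have "tight m \<phi> F (?C x \<union> ?C y)"
      using tight_Un_Int(1)[OF F_graph _ tx(1) _ ty(1)] sub by blast
    then show False using sep[of "?C x \<union> ?C y"] sub tx(2) ty(2) by blast
  qed
  have B': "base m \<phi> V B" "agree \<phi> (?C x) F B" and D': "base m \<phi> V D" "agree \<phi> (?C y) F D"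
    and BD: "B \<subseteq> E" "D \<subseteq> E"
    and B_deg: "\<And>v. v \<in> ?C x \<Longrightarrow> degree \<phi> B v \<le> h v" "degree \<phi> B x < h x"
    and D_deg: "\<And>v. v \<in> ?C y \<Longrightarrow> degree \<phi> D v \<le> h v" "degree \<phi> D y < h y"
    using B D unfolding locally_improvable_def by blast+
  obtain H where H: "base m \<phi> V H" "H \<subseteq> B \<union> D" and agrH: "agree \<phi> (?C x \<union> ?C y) F H"
    and tH: "tight m \<phi> H (?C x)" "tight m \<phi> H (?C y)"
    and H_iff: "\<And>e. \<not> \<phi> e \<subseteq> ?C x \<Longrightarrow> \<not> \<phi> e \<subseteq> ?C y \<Longrightarrow> e \<in> H \<longleftrightarrow> e \<in> F"
    and H_B: "\<And>v. v \<notin> ?C y \<Longrightarrow> degree \<phi> H v = degree \<phi> B v"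
    and H_D: "\<And>v. v \<notin> ?C x \<Longrightarrow> degree \<phi> H v = degree \<phi> D v"
    by (rule merge_bases[OF F(1) B' D' _ tx(1) _ ty(1) disj]) (use sub in blast)+
  \<comment> \<open>The ends of \<open>e\<close> lie in disjoint sets, so \<open>e\<close> is inside
    neither of them and is untouched by the merge.\<close>
  have eH: "e \<notin> H"
    using H_iff[of e] e(1,2) tx(2) ty(2) disj by auto
  have H_h: "degree \<phi> H v \<le> h v" if "v \<in> ?C x \<union> ?C y" for v
    using that B_deg(1) D_deg(1) H_B H_D disj by (metis UnE disjoint_iff)
  have H_F: "degree \<phi> H v = degree \<phi> F v" if "v \<notin> ?C x \<union> ?C y" for v
    using agree_degree[OF agrH that] .
  obtain X where X: "X \<subseteq> V" "tight m \<phi> H X" "x \<in> X" "y \<in> X"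
    and min: "\<And>Y. Y \<subseteq> V \<Longrightarrow> tight m \<phi> H Y \<Longrightarrow> x \<in> Y \<Longrightarrow> y \<in> Y \<Longrightarrow> X \<subseteq> Y"
    using minimal_tight[OF H(1) xy(2,3)] by metis
  \<comment> \<open>\<open>H\<close> differs from \<open>F\<close> only inside subsets of
    \<open>W\<close>, so \<open>W\<close> remains tight and bounds the set in which the exchange
    happens.\<close>
  have "tight m \<phi> H W"
    using agree_tight[OF F(1) H(1) agrH _ W(2)] W(3,4) by blast
  then have XW: "X \<subseteq> W"
    using min[OF W(1)] W(3,4) tx(2) ty(2) by blast
  \<comment> \<open>Otherwise \<open>X\<close> together with both components is tight in
    \<open>H\<close> and avoids \<open>S\<close>. It contains all the changes, so it is tight in
    \<open>F\<close> as well, contrary to \<open>sep\<close>.\<close>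
  have "X \<inter> S \<noteq> {}"
  proof
    assume XS: "X \<inter> S = {}"
    note gH = baseD(1,2)[OF H(1)]
    have "tight m \<phi> H (X \<union> ?C x)"
      by (rule tight_Un_Int(1)[OF gH X(1,2) _ tH(1)]) (use sub X(3) tx(2) in blast)+
    then have "tight m \<phi> H (X \<union> ?C x \<union> ?C y)"
      using tight_Un_Int(1)[OF gH _ _ _ tH(2), of "X \<union> ?C x"] sub X ty(2) by blast
    then have "tight m \<phi> F (X \<union> ?C x \<union> ?C y)"
      by (rule agree_tight[OF H(1) F(1) agree_sym[OF agrH], rotated]) blast
    then show False
      using sep[of "X \<union> ?C x \<union> ?C y"] sub X XS by blast
  qed
  then obtain z where z: "z \<in> X" "z \<in> S" by blast
  obtain g where g: "g \<in> inside \<phi> H X" "z \<in> \<phi> g"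
    by (rule tight_vertex_edge[OF baseD(1,2)[OF H(1)] m X(1,2) z(1)]) (use X(3) e(3) z(2) in blast)+
  define F' where "F' = insert e (H - {g})"
  have gH: "g \<in> H" "\<phi> g \<subseteq> X" using g by (auto simp: inside_def)
  have base: "base m \<phi> V F'"
    unfolding F'_def by (rule base_exchange[OF H(1) eH e(2) xy min g(1)])
  have finH: "finite H" using baseD(4)[OF H(1)] .
  have deg: "degree \<phi> F' v \<le> degree \<phi> H v" if "v \<notin> {x, y}" for v
    unfolding degree_def F'_def using that e(2) finH by (intro card_mono) auto
  have deg1: "degree \<phi> F' v \<le> degree \<phi> H v + 1" for v
  proof -
    have "degree \<phi> F' v \<le> card (insert e {e \<in> H. v \<in> \<phi> e})"
      unfolding degree_def F'_def using finH by (intro card_mono) auto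
    also have "\<dots> \<le> degree \<phi> H v + 1"
      using finH by (simp add: degree_def card_insert_if)
    finally show ?thesis .
  qed
  have zxy: "z \<notin> {x, y}" "z \<notin> ?C x \<union> ?C y"
    using z(2) e(3,4) sub[of x] sub[of y] by blast+
  show thesis
  proof
    show "z \<in> S \<inter> W" using z XW by blast
    show "F' \<subseteq> E" unfolding F'_def using H(2) BD e(1) by blast
    show "base m \<phi> V F'" by (rule base)
    show "agree \<phi> W F F'"
      unfolding agree_def
    proof (intro allI impI)
      fix a assume a: "\<not> \<phi> a \<subseteq> W"
      have "\<phi> e \<subseteq> W"
        unfolding e(2) using subsetD[OF W(3) tx(2)] subsetD[OF W(4) ty(2)] by simp
      then have "a \<noteq> e" using a by blast
      moreover have "a \<noteq> g" using a gH(2) XW by blast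
      ultimately show "a \<in> F \<longleftrightarrow> a \<in> F'"
        using H_iff[of a] a W(3,4) unfolding F'_def by blast
    qed
    have "degree \<phi> F' z \<le> card ({a \<in> H. z \<in> \<phi> a} - {g})"
      unfolding degree_def F'_def using zxy(1) e(2) finH by (intro card_mono) auto
    also have "\<dots> < degree \<phi> H z"
      unfolding degree_def by (rule card_Diff1_less) (use finH gH(1) g(2) in simp_all)
    finally have "degree \<phi> F' z < degree \<phi> H z" .
    then show "degree \<phi> F' z < degree \<phi> F z"
      using H_F[OF zxy(2)] by simp
    show "degree \<phi> F' v \<le> max (h v) (degree \<phi> F v)" for v
    proof (cases "v \<in> {x, y}")
      case True
      \<comment> \<open>The merge keeps the strict bounds at \<open>x\<close> and \<open>y\<close>,
        and these absorb the added edge.\<close>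
      have "x \<notin> ?C y" "y \<notin> ?C x" using disj tx(2) ty(2) by blast+
      then have "degree \<phi> H x < h x" "degree \<phi> H y < h y"
        using H_B[of x] H_D[of y] B_deg(2) D_deg(2) by simp_all
      then show ?thesis using True deg1[of v] by auto
    next
      case False
      then show ?thesis using deg[of v] H_h[of v] H_F[of v] by (cases "v \<in> ?C x \<union> ?C y") auto
    qed
  qed
qed

text \<open>The barrier is the stable stage of the sets \<open>B n\<close> for a base of least
  excess. An edge violating the claim at a late stage would give an exchange improving a vertex
  collected one stage earlier, and at the first stage an exchange lowering the excess.\<close>

lemma base_or_barrier:
  assumes m: "m > 0" and E: "graph_on \<phi> V E" and F0: "base m \<phi> V F0" "F0 \<subseteq> E"
  shows "(\<exists>F\<subseteq>E. base m \<phi> V F \<and> (\<forall>v\<in>V. degree \<phi> F v \<le> h v)) \<or>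
    (\<exists>F\<subseteq>E. \<exists>S\<subseteq>V. base m \<phi> V F \<and> (\<forall>v\<in>S. h v \<le> degree \<phi> F v) \<and> (\<exists>v\<in>S. h v < degree \<phi> F v) \<and>
      (\<forall>e\<in>E - F. \<phi> e \<subseteq> V - S \<longrightarrow> (\<exists>X\<subseteq>V - S. tight m \<phi> F X \<and> \<phi> e \<subseteq> X)))"
proof -
  have finV: "finite V" using E by (simp add: graph_on_def)
  \<comment> \<open>Truncated subtraction: vertices within the bound contribute nothing.\<close>
  define excess where "excess F = (\<Sum>v\<in>V. degree \<phi> F v - h v)" for F
  have "\<exists>F. (F \<subseteq> E \<and> base m \<phi> V F) \<and> (\<forall>F'. F' \<subseteq> E \<and> base m \<phi> V F' \<longrightarrow> excess F \<le> excess F')"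
    by (rule ex_has_least_nat[of _ F0]) (use F0 in blast)
  then obtain F where F: "F \<subseteq> E" "base m \<phi> V F"
    and least: "\<And>F'. F' \<subseteq> E \<Longrightarrow> base m \<phi> V F' \<Longrightarrow> excess F \<le> excess F'"
    by (elim exE conjE) blast
  note F_graph = baseD(1,2)[OF F(2)]
  define V0 where "V0 = {v \<in> V. h v < degree \<phi> F v}"
  define improvable where
    "improvable S v F' = locally_improvable m \<phi> V E h F (tight_comp m \<phi> F (V - S) v) v F'" for S v F'
  define step where "step S = S \<union> {v \<in> V - S. \<nexists>F'. improvable S v F'}" for S
  define B where "B n = (step ^^ n) V0" for n
  have B0: "B 0 = V0" and BSuc: "B (Suc n) = step (B n)" for n
    by (simp_all add: B_def)
  have step_V: "S \<subseteq> V \<Longrightarrow> step S \<subseteq> V" and step_mono: "S \<subseteq> step S" for S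
    by (auto simp: step_def)
  have B_V: "B n \<subseteq> V" for n
    by (induction n) (use step_V in \<open>auto simp: B0 BSuc V0_def\<close>)
  have V0_B: "V0 \<subseteq> B n" for n
    by (induction n) (use step_mono in \<open>auto simp: B0 BSuc\<close>)
  have h_ge: "h v \<le> degree \<phi> F v" if "v \<in> B n" for v n
    using that
  proof (induction n)
    case 0
    then show ?case by (simp add: B0 V0_def)
  next
    case (Suc n)
    show ?case
    proof (rule ccontr)
      assume less: "\<not> h v \<le> degree \<phi> F v"
      then have "v \<notin> B n" using Suc.IH by blast
      have "degree \<phi> F w \<le> h w" if "w \<in> V - B n" for w
        using that V0_B[of n] unfolding V0_def by force
      then have "\<forall>w\<in>tight_comp m \<phi> F (V - B n) v. degree \<phi> F w \<le> h w"
        using tight_comp_subset[of m \<phi> F "V - B n" v] by (meson subsetD)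
      \<comment> \<open>All vertices with excess are in \<open>B n\<close>, so if \<open>v\<close>
        is strictly below its bound, \<open>F\<close> itself is an improvement and \<open>v\<close>
        would not have been collected.\<close>
      then have "improvable (B n) v F"
        unfolding improvable_def locally_improvable_def using F less by (simp add: agree_def)
      then show False
        using Suc.prems \<open>v \<notin> B n\<close> by (auto simp: BSuc step_def)
    qed
  qed
  \<comment> \<open>The stages are shifted: the ends avoid \<open>B (Suc n)\<close>, but the tight
    set is only claimed to avoid \<open>B n\<close>. Once the sequence is stable the two
    coincide.\<close>
  have sep: "\<exists>X\<subseteq>V - B n. tight m \<phi> F X \<and> \<phi> e \<subseteq> X"
    if "e \<in> E - F" "\<phi> e = {x, y}" "x \<in> V - B (Suc n)" "y \<in> V - B (Suc n)" for e x y n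
    using that
  proof (induction n)
    case (Suc n)
    show ?case
    proof (rule ccontr)
      assume none: "\<not> ?case"
      have xy: "x \<in> V - B (Suc n)" "y \<in> V - B (Suc n)"
        using Suc.prems(3,4) step_mono[of "B (Suc n)"] BSuc[of "Suc n"] by blast+
      \<comment> \<open>The induction hypothesis puts both ends in one component \<open>W\<close> of
        the previous stage, which is where the exchange will take place.\<close>
      obtain Y where Y: "Y \<subseteq> V - B n" "tight m \<phi> F Y" "x \<in> Y" "y \<in> Y"
        using Suc.IH[OF Suc.prems(1,2) xy] Suc.prems(2) by auto
      define W where "W = tight_comp m \<phi> F (V - B n) x"
      have xW: "x \<in> V - B n" using Y by blast
      have W: "W \<subseteq> V - B n" "tight m \<phi> F W" "x \<in> W"
        unfolding W_def by (rule tight_comp_subset tight_comp[OF F_graph xW Diff_subset])+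
      have yW: "y \<in> W" using tight_comp_maximal[OF Y(1-3)] Y(4) unfolding W_def by blast
      have comp_W: "tight_comp m \<phi> F (V - B (Suc n)) u \<subseteq> W" if "u \<in> W" for u
      proof -
        have "tight_comp m \<phi> F (V - B (Suc n)) u \<subseteq> tight_comp m \<phi> F (V - B n) u"
          by (rule tight_comp_mono) (use step_mono[of "B n"] BSuc[of n] in blast)
        also have "\<dots> = W"
          using tight_comp_eq[OF F_graph Diff_subset xW, of u] that unfolding W_def by simp
        finally show ?thesis .
      qed
      \<comment> \<open>Since \<open>x\<close> was not collected in passing to
        \<open>B (Suc (Suc n))\<close>, it is improvable relative to
        \<open>B (Suc n)\<close>.\<close>
      obtain Bx where Bx: "improvable (B (Suc n)) x Bx"
        using Suc.prems(3) xy(1) unfolding BSuc[of "Suc n"] step_def by blast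
      obtain By where By: "improvable (B (Suc n)) y By"
        using Suc.prems(4) xy(2) unfolding BSuc[of "Suc n"] step_def by blast
      obtain F' z where z: "z \<in> B (Suc n) \<inter> W" and F': "F' \<subseteq> E" "base m \<phi> V F'" "agree \<phi> W F F'"
        and deg: "degree \<phi> F' z < degree \<phi> F z" "\<And>v. degree \<phi> F' v \<le> max (h v) (degree \<phi> F v)"
        by (rule augment[OF m E F(2,1) B_V Suc.prems(1,2) xy _ Bx[unfolded improvable_def]
              By[unfolded improvable_def] _ W(2) comp_W[OF W(3)] comp_W[OF yW]])
          (use none Suc.prems(2) W(1) in auto)
      have le: "degree \<phi> F v \<le> h v" if "v \<in> W" for v
        using that W(1) V0_B[of n] unfolding V0_def by force
      \<comment> \<open>\<open>z\<close> was collected in passing from \<open>B n\<close> to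
        \<open>B (Suc n)\<close>, hence was not improvable. Its component at that stage is
        \<open>W\<close>, and \<open>F'\<close> improves it there: a contradiction.\<close>
      have "z \<in> V - B n" using z W(1) by blast
      moreover have "tight_comp m \<phi> F (V - B n) z = W"
        using tight_comp_eq[OF F_graph Diff_subset xW, of z] z unfolding W_def by simp
      moreover have "degree \<phi> F' v \<le> h v" if "v \<in> W" for v
        using deg(2)[of v] le[OF that] by simp
      moreover have "degree \<phi> F' z < h z" using deg(1) le[of z] z by simp
      ultimately have "improvable (B n) z F'"
        unfolding improvable_def locally_improvable_def using F' by simp
      then show False using z W(1) unfolding BSuc[of n] step_def by blast
    qed
  next
    case 0
    show ?case
    proof (rule ccontr)
      assume none: "\<not> ?case"
      have xy: "x \<in> V - B 0" "y \<in> V - B 0"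
        using 0(3,4) step_mono[of "B 0"] BSuc[of 0] by blast+
      obtain Bx where Bx: "improvable (B 0) x Bx"
        using 0(3) xy(1) unfolding BSuc[of 0] step_def by blast
      obtain By where By: "improvable (B 0) y By"
        using 0(4) xy(2) unfolding BSuc[of 0] step_def by blast
      have sub: "tight_comp m \<phi> F (V - B 0) u \<subseteq> V" for u
        using tight_comp_subset[of m \<phi> F "V - B 0" u] by blast
      obtain F' z where z: "z \<in> B 0 \<inter> V" and F': "F' \<subseteq> E" "base m \<phi> V F'" "agree \<phi> V F F'"
        and deg: "degree \<phi> F' z < degree \<phi> F z" "\<And>v. degree \<phi> F' v \<le> max (h v) (degree \<phi> F v)"
        by (rule augment[OF m E F(2,1) B_V 0(1,2) xy _ Bx[unfolded improvable_def]
              By[unfolded improvable_def] order_refl baseD(3)[OF F(2)] sub sub])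
          (use none 0(2) in auto)
      \<comment> \<open>No vertex gains excess, and \<open>z\<close> lies in \<open>V0\<close>, so
        it has positive excess and loses some of it.\<close>
      have "excess F' < excess F"
        unfolding excess_def
      proof (rule sum_strict_mono_ex1[OF finV])
        show "\<forall>v\<in>V. degree \<phi> F' v - h v \<le> degree \<phi> F v - h v"
          using deg(2) by (metis diff_le_mono diff_is_0_eq le_max_iff_disj max_def order_refl zero_le)
        show "\<exists>v\<in>V. degree \<phi> F' v - h v < degree \<phi> F v - h v"
          using z deg(1) unfolding B0 V0_def by (intro bexI[of _ z]) auto
      qed
      then show False using least[OF F'(1,2)] by simp
    qed
  qed
  \<comment> \<open>A strictly increasing sequence of subsets of the finite set \<open>V\<close> is
    impossible.\<close>
  have "\<exists>n. B (Suc n) = B n"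
  proof (rule ccontr)
    assume "\<not> ?thesis"
    then have "B n \<subset> B (Suc n)" for n
      using step_mono BSuc by (metis psubsetI)
    then have less: "card (B n) < card (B (Suc n))" for n
      using B_V finV finite_subset psubset_card_mono by metis
    have "n \<le> card (B n)" for n
      by (induction n) (use less in \<open>auto simp: Suc_le_eq intro: le_less_trans\<close>)
    moreover have "card (B n) \<le> card V" for n
      using B_V finV by (simp add: card_mono)
    ultimately show False by (metis Suc_n_not_le_n order_trans)
  qed
  then obtain n where n: "B (Suc n) = B n" by blast
  show ?thesis
  proof (cases "V0 = {}")
    case True
    then have "\<forall>v\<in>V. degree \<phi> F v \<le> h v" unfolding V0_def by (auto simp: not_less)
    then show ?thesis using F by blast
  next
    case False
    then have ex: "\<exists>v\<in>B n. h v < degree \<phi> F v" using V0_B[of n] unfolding V0_def by blast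
    have all: "\<forall>v\<in>B n. h v \<le> degree \<phi> F v" using h_ge by blast
    have "\<forall>e\<in>E - F. \<phi> e \<subseteq> V - B n \<longrightarrow> (\<exists>X\<subseteq>V - B n. tight m \<phi> F X \<and> \<phi> e \<subseteq> X)"
    proof (intro ballI impI)
      fix e assume e: "e \<in> E - F" "\<phi> e \<subseteq> V - B n"
      have "card (\<phi> e) = 2" using e(1) E by (simp add: graph_on_def)
      then obtain x y where "\<phi> e = {x, y}" by (auto simp: card_2_iff)
      then show "\<exists>X\<subseteq>V - B n. tight m \<phi> F X \<and> \<phi> e \<subseteq> X"
        using sep[OF e(1), of x y n] e(2) n by simp
    qed
    then show ?thesis
      by (intro disjI2 exI[of _ F] exI[of _ "B n"] conjI F B_V all ex)
  qed
qed

section \<open>Bases are unions of two trees\<close>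

text \<open>Connectedness in terms of cuts is easy to maintain when vertices and edges are added;
  its equivalence with connectedness by walks is
  \<open>connected_graph_iff_cut_connected\<close>.\<close>

definition cut_connected :: "('e \<Rightarrow> 'v set) \<Rightarrow> 'v set \<Rightarrow> 'e set \<Rightarrow> bool" where
  "cut_connected \<phi> V T \<longleftrightarrow> V \<noteq> {} \<and>
     (\<forall>Z\<subseteq>V. Z \<noteq> {} \<longrightarrow> Z \<noteq> V \<longrightarrow> (\<exists>e\<in>T. \<phi> e \<inter> Z \<noteq> {} \<and> \<phi> e \<inter> (V - Z) \<noteq> {}))"

text \<open>Trees appear as connected edge sets with one edge fewer than vertices; that they have no
  cycles is derived through \<open>cut_tree_base\<close>.\<close>

definition cut_tree :: "('e \<Rightarrow> 'v set) \<Rightarrow> 'v set \<Rightarrow> 'e set \<Rightarrow> bool" where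
  "cut_tree \<phi> V T \<longleftrightarrow> cut_connected \<phi> V T \<and> finite T \<and> card T + 1 = card V"

lemma cut_connectedD:
  assumes "cut_connected \<phi> V T" "Z \<subseteq> V" "Z \<noteq> {}" "Z \<noteq> V"
  obtains e where "e \<in> T" "\<phi> e \<inter> Z \<noteq> {}" "\<phi> e \<inter> (V - Z) \<noteq> {}"
proof -
  have "\<exists>e\<in>T. \<phi> e \<inter> Z \<noteq> {} \<and> \<phi> e \<inter> (V - Z) \<noteq> {}"
    using assms unfolding cut_connected_def by simp
  then show thesis using that by (elim bexE conjE)
qed

lemma cut_connected_leaf:
  assumes T: "cut_connected \<phi> V T" and u: "u \<in> V" and e: "\<phi> e = {v, u}"
  shows "cut_connected \<phi> (insert v V) (insert e T)"
  unfolding cut_connected_def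
proof (intro conjI allI impI)
  fix Z assume Z: "Z \<subseteq> insert v V" "Z \<noteq> {}" "Z \<noteq> insert v V"
  show "\<exists>e'\<in>insert e T. \<phi> e' \<inter> Z \<noteq> {} \<and> \<phi> e' \<inter> (insert v V - Z) \<noteq> {}"
  proof (cases "Z \<inter> V = {} \<or> Z \<inter> V = V")
    case True
    then have "\<phi> e \<inter> Z \<noteq> {} \<and> \<phi> e \<inter> (insert v V - Z) \<noteq> {}"
      unfolding e using Z u by blast
    then show ?thesis by blast
  next
    case False
    obtain e' where "e' \<in> T" "\<phi> e' \<inter> (Z \<inter> V) \<noteq> {}" "\<phi> e' \<inter> (V - Z \<inter> V) \<noteq> {}"
      using cut_connectedD[OF T, of "Z \<inter> V"] False by auto
    then show ?thesis by (intro bexI[of _ e']) auto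
  qed
qed simp

text \<open>Undoes a splitting off: the edge named \<open>e\<close> joins \<open>a\<close> and
  \<open>b\<close> in the modified incidence map, and the path \<open>a v b\<close> takes its place.
  Whichever side of a cut \<open>v\<close> is on, the path crosses the cut if \<open>ab\<close>
  did.\<close>

lemma cut_connected_subdivide:
  assumes T: "cut_connected (\<phi>(e := {a, b})) V T" and "e \<in> T" and ab: "a \<in> V" "b \<in> V" "v \<notin> V"
    and e: "\<phi> e = {v, a}" and e': "\<phi> e' = {v, b}"
  shows "cut_connected \<phi> (insert v V) (insert e' T)"
  unfolding cut_connected_def
proof (intro conjI allI impI)
  fix Z assume Z: "Z \<subseteq> insert v V" "Z \<noteq> {}" "Z \<noteq> insert v V"
  let ?crosses = "\<lambda>g. \<phi> g \<inter> Z \<noteq> {} \<and> \<phi> g \<inter> (insert v V - Z) \<noteq> {}"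
  have "?crosses e \<or> ?crosses e' \<or> (\<exists>g\<in>T. ?crosses g)"
  proof (cases "Z \<inter> V = {} \<or> Z \<inter> V = V")
    case True
    then have "?crosses e" unfolding e using Z ab by blast
    then show ?thesis by blast
  next
    case False
    obtain g where g: "g \<in> T" "(\<phi>(e := {a, b})) g \<inter> (Z \<inter> V) \<noteq> {}"
      "(\<phi>(e := {a, b})) g \<inter> (V - Z \<inter> V) \<noteq> {}"
      using cut_connectedD[OF T, of "Z \<inter> V"] False by auto
    show ?thesis
    proof (cases "g = e")
      case True
      then have "?crosses e \<or> ?crosses e'" unfolding e e' using g ab by auto
      then show ?thesis by blast
    next
      case False
      then show ?thesis using g by (intro disjI2 bexI[of _ g]) auto
    qed
  qed
  then show "\<exists>g\<in>insert e' T. ?crosses g" using \<open>e \<in> T\<close> by blast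
qed simp

lemma cut_connected_cong:
  "(\<And>e. e \<in> T \<Longrightarrow> \<phi> e = \<psi> e) \<Longrightarrow> cut_connected \<phi> V T \<longleftrightarrow> cut_connected \<psi> V T"
  unfolding cut_connected_def by simp

section \<open>Degree sums and splitting off\<close>

lemma sum_degree:
  assumes "finite F" "finite S"
  shows "(\<Sum>v\<in>S. degree \<phi> F v) = (\<Sum>e\<in>F. card (\<phi> e \<inter> S))"
proof -
  have "(\<Sum>v\<in>S. degree \<phi> F v) = (\<Sum>v\<in>S. \<Sum>e | e \<in> F \<and> v \<in> \<phi> e. 1)"
    by (simp add: degree_def)
  also have "\<dots> = (\<Sum>e\<in>F. \<Sum>v | v \<in> S \<and> v \<in> \<phi> e. 1)"
    using assms(2,1) by (rule sum.swap_restrict)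
  also have "\<dots> = (\<Sum>e\<in>F. card (\<phi> e \<inter> S))"
    by (simp add: Int_def conj_commute)
  finally show ?thesis .
qed

lemma handshake:
  assumes "graph_on \<phi> V F"
  shows "(\<Sum>v\<in>V. degree \<phi> F v) = 2 * card F"
proof -
  have "(\<Sum>e\<in>F. card (\<phi> e \<inter> V)) = (\<Sum>e\<in>F. 2)"
    using assms by (intro sum.cong) (auto simp: graph_on_def Int_absorb2)
  then show ?thesis using assms by (simp add: sum_degree graph_on_def)
qed

lemma other_end:
  assumes "graph_on \<phi> V F" "e \<in> F" "v \<in> \<phi> e"
  obtains u where "\<phi> e = {v, u}" "u \<in> V" "u \<noteq> v"
proof -
  have *: "card (\<phi> e) = 2" "\<phi> e \<subseteq> V" using assms by (simp_all add: graph_on_def)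
  then obtain x y where xy: "\<phi> e = {x, y}" "x \<noteq> y" by (auto simp: card_2_iff)
  show thesis
    using that[of x] that[of y] xy *(2) assms(3) by auto
qed

text \<open>A tight set avoiding \<open>v\<close> cannot contain all three neighbours: adding
  \<open>v\<close> would bring three edges, while the bound grows by two. If tight sets blocked both
  \<open>ab\<close> and \<open>bc\<close>, they would share \<open>b\<close> and their union would
  be such a set. So one of the pairs can be split off.\<close>

lemma splitting_pair:
  assumes F: "graph_on \<phi> V F" "sparse 2 \<phi> V F" and v: "v \<in> V" and deg: "degree \<phi> F v = 3"
  obtains e1 e2 e3 a b c where "{e \<in> F. v \<in> \<phi> e} = {e1, e2, e3}" "e1 \<noteq> e2" "e1 \<noteq> e3" "e2 \<noteq> e3"
    "\<phi> e1 = {v, a}" "\<phi> e2 = {v, b}" "\<phi> e3 = {v, c}" "a \<noteq> b" "{a, b, c} \<subseteq> V - {v}"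
    "\<And>X. X \<subseteq> V - {v} \<Longrightarrow> tight 2 \<phi> F X \<Longrightarrow> \<not> {a, b} \<subseteq> X"
proof -
  have finF: "finite F" and finV: "finite V" using F(1) by (auto simp: graph_on_def)
  let ?D = "{e \<in> F. v \<in> \<phi> e}"
  obtain e1 e2 e3 where D: "?D = {e1, e2, e3}" "e1 \<noteq> e2" "e1 \<noteq> e3" "e2 \<noteq> e3"
    using deg unfolding degree_def card_3_iff by blast
  then have eF: "e1 \<in> F" "e2 \<in> F" "e3 \<in> F" "v \<in> \<phi> e1" "v \<in> \<phi> e2" "v \<in> \<phi> e3" by blast+
  obtain a where a: "\<phi> e1 = {v, a}" "a \<in> V" "a \<noteq> v" using other_end[OF F(1) eF(1,4)] .
  obtain b where b: "\<phi> e2 = {v, b}" "b \<in> V" "b \<noteq> v" using other_end[OF F(1) eF(2,5)] .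
  obtain c where c: "\<phi> e3 = {v, c}" "c \<in> V" "c \<noteq> v" using other_end[OF F(1) eF(3,6)] .
  have not_all: "\<not> {a, b, c} \<subseteq> X" if X: "X \<subseteq> V - {v}" "tight 2 \<phi> F X" for X
  proof
    assume abc: "{a, b, c} \<subseteq> X"
    have "v \<notin> X" "finite X" using X(1) finV finite_subset by blast+
    have "card (inside \<phi> F X \<union> ?D) = card (inside \<phi> F X) + card ?D"
      by (rule card_Un_disjoint) (use finF \<open>v \<notin> X\<close> in \<open>auto simp: inside_def\<close>)
    moreover have "inside \<phi> F X \<union> ?D \<subseteq> inside \<phi> F (insert v X)"
      unfolding D(1) inside_def using eF a(1) b(1) c(1) abc by auto
    then have "card (inside \<phi> F X \<union> ?D) \<le> card (inside \<phi> F (insert v X))"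
      using finF by (intro card_mono finite_inside)
    moreover have "card (inside \<phi> F (insert v X)) + 2 \<le> 2 * card (insert v X)"
      by (rule sparseD[OF F(2)]) (use X v in auto)
    ultimately show False
      using X(2) deg \<open>v \<notin> X\<close> \<open>finite X\<close> by (simp add: tight_def degree_def)
  qed
  define blocked where "blocked p q \<longleftrightarrow> (\<exists>X\<subseteq>V - {v}. tight 2 \<phi> F X \<and> {p, q} \<subseteq> X)" for p q
  \<comment> \<open>Singletons are tight, so an unblocked pair automatically consists of distinct
    vertices.\<close>
  have blocked_refl: "blocked p p" if "p \<in> V - {v}" for p
    unfolding blocked_def using tight_singleton[OF F(1), of 2 p] that by blast
  have "\<not> (blocked a b \<and> blocked b c)"
  proof
    assume "blocked a b \<and> blocked b c"
    then obtain X Y where X: "X \<subseteq> V - {v}" "tight 2 \<phi> F X" "{a, b} \<subseteq> X"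
      and Y: "Y \<subseteq> V - {v}" "tight 2 \<phi> F Y" "{b, c} \<subseteq> Y" unfolding blocked_def by blast
    have "tight 2 \<phi> F (X \<union> Y)"
      by (rule tight_Un_Int(1)[OF F _ X(2) _ Y(2)]) (use X Y in auto)
    then show False using not_all[of "X \<union> Y"] X Y by blast
  qed
  then consider "\<not> blocked a b" | "\<not> blocked b c" by blast
  then show thesis
  proof cases
    case 1
    then have "a \<noteq> b" using blocked_refl a by blast
    show thesis
      by (rule that[OF D a(1) b(1) c(1) \<open>a \<noteq> b\<close>]) (use a b c 1 in \<open>auto simp: blocked_def\<close>)
  next
    case 2
    then have "b \<noteq> c" using blocked_refl b by blast
    \<comment> \<open>Cyclic renaming, so that \<open>b\<close> and \<open>c\<close> become the pair
      to be joined.\<close>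
    have D': "?D = {e2, e3, e1}" using D(1) by auto
    show thesis
      by (rule that[OF D' D(4) D(2)[symmetric] D(3)[symmetric] b(1) c(1) a(1) \<open>b \<noteq> c\<close>])
        (use a b c 2 in \<open>auto simp: blocked_def\<close>)
  qed
qed

text \<open>Induction that removes a vertex of degree two or three. In the first case its edges
  become leaf edges of the two trees. In the second, two of its edges are first merged into one;
  reinserting the vertex subdivides the tree using that edge and attaches a leaf to the
  other.\<close>

lemma base_two_trees:
  assumes "base 2 \<phi> V F"
  shows "\<exists>T1\<subseteq>F. \<exists>T2\<subseteq>F. T1 \<inter> T2 = {} \<and> cut_tree \<phi> V T1 \<and> cut_tree \<phi> V T2"
  using assms
proof (induction "card V" arbitrary: \<phi> V F rule: less_induct)
  case less
  note F = less.prems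
  have finF: "finite F" and finV: "finite V" using baseD(4,5)[OF F] .
  have cardF: "card F + 2 = 2 * card V"
    using baseD(1,3)[OF F] by (simp add: tight_def inside_all)
  then have "V \<noteq> {}" by auto
  show ?case
  proof (cases "card V = 1")
    case True
    then have "cut_tree \<phi> V {}"
      unfolding cut_tree_def cut_connected_def by (auto simp: card_1_singleton_iff subset_singleton_iff)
    then show ?thesis by blast
  next
    case False
    \<comment> \<open>The degree sum is \<open>4 * card V - 4\<close>, so not all degrees are at
      least four.\<close>
    have "\<exists>v\<in>V. degree \<phi> F v \<le> 3"
    proof (rule ccontr)
      assume "\<not> ?thesis"
      then have "(\<Sum>v\<in>V. 4) \<le> (\<Sum>v\<in>V. degree \<phi> F v)"
        by (intro sum_mono) force
      then show False using handshake[OF baseD(1)[OF F]] cardF by simp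
    qed
    then obtain v where v: "v \<in> V" "degree \<phi> F v \<le> 3" by blast
    define V' where "V' = V - {v}"
    define D where "D = {e \<in> F. v \<in> \<phi> e}"
    have V': "V = insert v V'" "v \<notin> V'" "finite V'" "card V = card V' + 1"
      using v(1) finV card_Suc_Diff1[OF finV v(1)] by (auto simp: V'_def)
    have "V' \<noteq> {}" using False V'(4) by auto
    have sparse: "card (inside \<phi> F X) + 2 \<le> 2 * card X" if "X \<subseteq> V'" "X \<noteq> {}" for X
      by (rule sparseD[OF baseD(2)[OF F]]) (use that V'(1) in auto)
    have "inside \<phi> F V' = F - D"
      using baseD(6)[OF F] V'(1,2) by (auto simp: inside_def D_def)
    moreover have "D \<subseteq> F" "finite D" using finF by (auto simp: D_def)
    ultimately have "card (inside \<phi> F V') + card D = card F"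
      using finF by (simp add: card_Diff_subset card_mono)
    \<comment> \<open>At most \<open>2 * card V - 4\<close> of the \<open>2 * card V - 2\<close>
      edges avoid \<open>v\<close>.\<close>
    then have "card D \<ge> 2"
      using sparse[OF order_refl \<open>V' \<noteq> {}\<close>] cardF V'(4) by linarith
    moreover have "card D = degree \<phi> F v" by (simp add: D_def degree_def)
    ultimately consider "card D = 2" | "degree \<phi> F v = 3" using v(2) by linarith
    then show ?thesis
    proof cases
      case 1
      then obtain e1 e2 where D: "D = {e1, e2}" "e1 \<noteq> e2" unfolding card_2_iff by blast
      then have eF: "e1 \<in> F" "e2 \<in> F" "v \<in> \<phi> e1" "v \<in> \<phi> e2" by (auto simp: D_def)
      obtain a where a: "\<phi> e1 = {v, a}" "a \<in> V" "a \<noteq> v" using other_end[OF baseD(1)[OF F] eF(1,3)] .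
      obtain b where b: "\<phi> e2 = {v, b}" "b \<in> V" "b \<noteq> v" using other_end[OF baseD(1)[OF F] eF(2,4)] .
      have gr: "graph_on \<phi> V' (F - D)"
        using baseD(1)[OF F] V'(1,3) by (auto simp: graph_on_def D_def)
      have "card (inside \<phi> (F - D) X) + 2 \<le> 2 * card X" if "X \<subseteq> V'" "X \<noteq> {}" for X
      proof -
        have "card (inside \<phi> (F - D) X) \<le> card (inside \<phi> F X)"
          using finF by (intro card_mono finite_inside) (auto simp: inside_def)
        then show ?thesis using sparse[OF that] by linarith
      qed
      moreover have "card (F - D) + 2 = 2 * card V'"
        using cardF V'(3,4) 1 \<open>D \<subseteq> F\<close> \<open>finite D\<close> \<open>V' \<noteq> {}\<close> card_gt_0_iff[of V']
        by (simp add: card_Diff_subset)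
      ultimately have "base 2 \<phi> V' (F - D)"
        using gr by (simp add: base_def sparse_def tight_def inside_all)
      from less.hyps[OF _ this] obtain T1 T2 where T: "T1 \<subseteq> F - D" "T2 \<subseteq> F - D" "T1 \<inter> T2 = {}"
        "cut_tree \<phi> V' T1" "cut_tree \<phi> V' T2"
        using V'(4) by (elim exE conjE meta_impE) simp_all
      have "e1 \<notin> T1" "e2 \<notin> T2" using T D by auto
      then have "cut_tree \<phi> V (insert e1 T1)" "cut_tree \<phi> V (insert e2 T2)"
        using T(4,5) cut_connected_leaf[of \<phi> V' T1 a e1 v] cut_connected_leaf[of \<phi> V' T2 b e2 v]
          a b V' by (auto simp: cut_tree_def)
      moreover have "insert e1 T1 \<inter> insert e2 T2 = {}" using T(1-3) D by blast
      moreover have "insert e1 T1 \<subseteq> F" "insert e2 T2 \<subseteq> F" using T(1,2) eF by blast+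
      ultimately show ?thesis by blast
    next
      case 2
      obtain e1 e2 e3 a b c where D: "D = {e1, e2, e3}" "e1 \<noteq> e2" "e1 \<noteq> e3" "e2 \<noteq> e3"
        and e: "\<phi> e1 = {v, a}" "\<phi> e2 = {v, b}" "\<phi> e3 = {v, c}" and ab: "a \<noteq> b" "{a, b, c} \<subseteq> V'"
        and unblocked: "\<And>X. X \<subseteq> V' \<Longrightarrow> tight 2 \<phi> F X \<Longrightarrow> \<not> {a, b} \<subseteq> X"
        by (rule splitting_pair[OF baseD(1,2)[OF F] v(1) 2]) (simp add: D_def V'_def)
      have eF: "e1 \<in> F" "e2 \<in> F" "e3 \<in> F" using D(1) by (auto simp: D_def)
      \<comment> \<open>Splitting off at \<open>v\<close> keeps the name \<open>e1\<close> for the new edge \<open>ab\<close>.\<close>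
      define \<psi> where "\<psi> = \<phi>(e1 := {a, b})"
      define F' where "F' = F - {e2, e3}"
      have "\<psi> g \<subseteq> V' \<and> card (\<psi> g) = 2" if g: "g \<in> F'" for g
      proof (cases "g = e1")
        case True
        then show ?thesis using ab by (auto simp: \<psi>_def)
      next
        case False
        then have "v \<notin> \<phi> g" "g \<in> F" using g D(1) by (auto simp: F'_def D_def)
        then show ?thesis
          using False baseD(6,7)[OF F \<open>g \<in> F\<close>] V'(1) by (auto simp: \<psi>_def)
      qed
      then have gr: "graph_on \<psi> V' F'"
        using V'(3) finF by (simp add: graph_on_def F'_def)
      \<comment> \<open>The new edge adds at most one inside \<open>X\<close>, and only if
        \<open>X\<close> contains \<open>a\<close> and \<open>b\<close>; such an \<open>X\<close> is
        not tight, so there is room.\<close>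
      have "card (inside \<psi> F' X) + 2 \<le> 2 * card X" if X: "X \<subseteq> V'" "X \<noteq> {}" for X
      proof (cases "{a, b} \<subseteq> X")
        case True
        have "card (inside \<psi> F' X) \<le> card (insert e1 (inside \<phi> F X))"
          using finF finite_inside[of F]
          by (intro card_mono) (auto simp: inside_def \<psi>_def F'_def split: if_splits)
        also have "\<dots> \<le> card (inside \<phi> F X) + 1"
          using finF by (simp add: card_insert_if finite_inside)
        finally show ?thesis
          using sparse[OF X] unblocked[OF X(1)] True unfolding tight_def by linarith
      next
        case False
        then have "card (inside \<psi> F' X) \<le> card (inside \<phi> F X)"
          using finF by (intro card_mono finite_inside)
            (auto simp: inside_def \<psi>_def F'_def split: if_splits)
        then show ?thesis using sparse[OF X] by linarith
      qed
      moreover have "card F' + 2 = 2 * card V'"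
      proof -
        have "card F' = card F - card {e2, e3}"
          unfolding F'_def using eF by (intro card_Diff_subset) auto
        moreover have "card V' > 0" using \<open>V' \<noteq> {}\<close> V'(3) by (simp add: card_gt_0_iff)
        ultimately show ?thesis using cardF V'(4) D(4) by simp
      qed
      ultimately have "base 2 \<psi> V' F'"
        using gr by (simp add: base_def sparse_def tight_def inside_all)
      from less.hyps[OF _ this] obtain U1 U2 where U: "U1 \<subseteq> F'" "U2 \<subseteq> F'" "U1 \<inter> U2 = {}"
        "cut_tree \<psi> V' U1" "cut_tree \<psi> V' U2"
        using V'(4) by (elim exE conjE meta_impE) simp_all
      \<comment> \<open>The trees are named so that the split edge, if it is used, belongs to
        \<open>T1\<close>.\<close>
      obtain T1 T2 where T: "T1 \<subseteq> F'" "T2 \<subseteq> F'" "T1 \<inter> T2 = {}"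
        "cut_tree \<psi> V' T1" "cut_tree \<psi> V' T2" "e1 \<notin> T2"
      proof (cases "e1 \<in> U2")
        case True
        then show thesis using that[of U2 U1] U by blast
      next
        case False
        then show thesis using that[of U1 U2] U by blast
      qed
      have tree_cong: "cut_connected \<phi> V' T" if T: "cut_connected \<psi> V' T" "e1 \<notin> T" for T
      proof -
        have "\<phi> e = \<psi> e" if "e \<in> T" for e using that T(2) by (auto simp: \<psi>_def)
        then show ?thesis using cut_connected_cong[of T \<phi> \<psi> V'] T(1) by simp
      qed
      \<comment> \<open>If \<open>T1\<close> uses the split edge, \<open>e1\<close> and
        \<open>e2\<close> form the path replacing it; otherwise \<open>e2\<close> attaches
        \<open>v\<close> as a leaf.\<close>
      have "cut_connected \<phi> V (insert e2 T1)"
      proof (cases "e1 \<in> T1")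
        case True
        show ?thesis
          unfolding V'(1)
          by (rule cut_connected_subdivide[OF _ True _ _ V'(2) e(1,2)])
            (use T(4) ab in \<open>auto simp: cut_tree_def \<psi>_def\<close>)
      next
        case False
        then show ?thesis
          unfolding V'(1) using T(4) ab
          by (intro cut_connected_leaf[OF tree_cong _ e(2)]) (auto simp: cut_tree_def)
      qed
      moreover have "cut_connected \<phi> V (insert e3 T2)"
        unfolding V'(1) using T(5,6) ab
        by (intro cut_connected_leaf[OF tree_cong _ e(3)]) (auto simp: cut_tree_def)
      moreover have "e2 \<notin> T1 \<union> T2" "e3 \<notin> T1 \<union> T2" using T(1,2) by (auto simp: F'_def)
      ultimately have "cut_tree \<phi> V (insert e2 T1)" "cut_tree \<phi> V (insert e3 T2)"
        using T(4,5) V'(4) by (auto simp: cut_tree_def)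
      moreover have "insert e2 T1 \<inter> insert e3 T2 = {}"
        using T(3) D(4) \<open>e2 \<notin> T1 \<union> T2\<close> \<open>e3 \<notin> T1 \<union> T2\<close> by blast
      moreover have "insert e2 T1 \<subseteq> F" "insert e3 T2 \<subseteq> F" using T(1,2) eF by (auto simp: F'_def)
      ultimately show ?thesis by blast
    qed
  qed
qed

section \<open>Trees as bases for \<open>m = 1\<close>\<close>

text \<open>A set containing \<open>w\<close> and another vertex has at most one more edge than it
  has without \<open>w\<close>, which matches its one additional vertex.\<close>

lemma base_leaf:
  assumes T: "base 1 \<phi> X T" and e: "\<phi> e = {w, u}" "u \<in> X" "w \<notin> X"
  shows "base 1 \<phi> (insert w X) (insert e T)"
proof -
  note fin = baseD(4,5)[OF T]
  have eT: "e \<notin> T" using baseD(6)[OF T, of e] e by auto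
  have "w \<noteq> u" using e by blast
  then have gr: "graph_on \<phi> (insert w X) (insert e T)"
    using baseD(1)[OF T] e by (auto simp: graph_on_def)
  have "card (inside \<phi> (insert e T) Z) + 1 \<le> card Z" if Z: "Z \<subseteq> insert w X" "Z \<noteq> {}" for Z
  proof (cases "w \<in> Z \<and> Z \<noteq> {w}")
    case True
    have finZ: "finite Z" using Z(1) fin(2) finite_subset by blast
    have "inside \<phi> (insert e T) Z \<subseteq> insert e (inside \<phi> T (Z - {w}))"
      using baseD(6)[OF T] e(3) by (fastforce simp: inside_def)
    then have "card (inside \<phi> (insert e T) Z) \<le> card (insert e (inside \<phi> T (Z - {w})))"
      using fin by (intro card_mono) (auto intro: finite_inside)
    also have "\<dots> \<le> card (inside \<phi> T (Z - {w})) + 1"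
      using fin by (simp add: card_insert_if finite_inside)
    also have "\<dots> \<le> card (Z - {w})"
      using sparseD[OF baseD(2)[OF T], of "Z - {w}"] Z True by auto
    finally show ?thesis using card_Suc_Diff1[OF finZ, of w] True by simp
  next
    case False
    have "\<not> {w, u} \<subseteq> Z" using False e(2,3) by auto
    then have eq: "inside \<phi> (insert e T) Z = inside \<phi> T Z"
      unfolding inside_def using e(1) by auto
    show ?thesis
    proof (cases "w \<in> Z")
      case True
      then have "Z = {w}" using False by blast
      moreover have "inside \<phi> T {w} = {}"
        using baseD(6,7)[OF T] e(3) by (fastforce simp: inside_def subset_singleton_iff)
      ultimately show ?thesis using eq by simp
    next
      case False
      then show ?thesis using sparseD[OF baseD(2)[OF T], of Z] Z eq by auto
    qed
  qed
  moreover have "tight 1 \<phi> (insert e T) (insert w X)"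
    using baseD(1,3)[OF T] gr fin eT e(3) by (simp add: tight_def inside_all)
  ultimately show ?thesis using gr by (simp add: base_def sparse_def)
qed

text \<open>A tree is grown one vertex at a time: as long as its vertex set \<open>X\<close> is not
  all of \<open>V\<close>, some edge leaves \<open>X\<close> and can be added as a leaf
  edge.\<close>

lemma cut_connected_base:
  assumes G: "graph_on \<phi> V T" and con: "cut_connected \<phi> V T"
  obtains T' where "T' \<subseteq> T" "base 1 \<phi> V T'"
proof -
  have finV: "finite V" using G by (simp add: graph_on_def)
  have "\<exists>X\<subseteq>V. card X = Suc k \<and> (\<exists>T'\<subseteq>T. base 1 \<phi> X T')" if "Suc k \<le> card V" for k
    using that
  proof (induction k)
    case 0
    obtain v where "v \<in> V" using con by (auto simp: cut_connected_def)
    moreover have "base 1 \<phi> {v} {}"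
      by (auto simp: base_def graph_on_def sparse_def tight_def inside_def Suc_le_eq card_gt_0_iff
          finite_subset)
    ultimately show ?case by (intro exI[of _ "{v}"]) auto
  next
    case (Suc k)
    then obtain X T' where X: "X \<subseteq> V" "card X = Suc k" and T': "T' \<subseteq> T" "base 1 \<phi> X T'"
      by auto
    have "X \<noteq> {}" "X \<noteq> V" using X(2) Suc.prems by auto
    then obtain e where e: "e \<in> T" "\<phi> e \<inter> X \<noteq> {}" "\<phi> e \<inter> (V - X) \<noteq> {}"
      using cut_connectedD[OF con X(1)] by blast
    obtain w where w: "w \<in> \<phi> e" "w \<in> V" "w \<notin> X" using e(3) by blast
    obtain u where u: "\<phi> e = {w, u}" using other_end[OF G e(1) w(1)] .
    have "u \<in> X" using e(2) u w(3) by auto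
    then have "base 1 \<phi> (insert w X) (insert e T')"
      using base_leaf[OF T'(2) u] w(3) by blast
    moreover have "card (insert w X) = Suc (Suc k)"
      using X w(3) finV finite_subset[of X V] by simp
    ultimately show ?case using X(1) w(2) e(1) T'(1)
      by (intro exI[of _ "insert w X"] conjI exI[of _ "insert e T'"]) auto
  qed
  moreover have "card V > 0" using con finV by (simp add: cut_connected_def card_gt_0_iff)
  ultimately obtain X T' where X: "X \<subseteq> V" "card X = card V" and T': "T' \<subseteq> T" "base 1 \<phi> X T'"
    by (metis Suc_pred order_refl)
  have "X = V" using X finV by (simp add: card_subset_eq)
  then show thesis using that T' by blast
qed

text \<open>The base found inside \<open>T\<close> has as many edges as \<open>T\<close>, so it is
  all of \<open>T\<close>.\<close>

lemma cut_tree_base: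
  assumes G: "graph_on \<phi> V T" and tree: "cut_tree \<phi> V T"
  shows "base 1 \<phi> V T"
proof -
  obtain T' where T': "T' \<subseteq> T" "base 1 \<phi> V T'"
    using cut_connected_base[OF G] tree by (auto simp: cut_tree_def)
  then have "card T' = card T"
    using baseD(1,3)[OF T'(2)] tree by (simp add: tight_def inside_all cut_tree_def)
  then have "T' = T"
    using T'(1) tree by (simp add: card_subset_eq cut_tree_def)
  then show ?thesis using T'(2) by simp
qed

lemma base_Un:
  assumes A: "base k \<phi> V A" and B: "base m \<phi> V B" and disj: "A \<inter> B = {}"
  shows "base (k + m) \<phi> V (A \<union> B)"
proof -
  have card: "card (inside \<phi> (A \<union> B) X) = card (inside \<phi> A X) + card (inside \<phi> B X)" for X
  proof -
    have "inside \<phi> (A \<union> B) X = inside \<phi> A X \<union> inside \<phi> B X" by (auto simp: inside_def)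
    then show ?thesis
      using disj baseD(4)[OF A] baseD(4)[OF B] inside_subset[of \<phi> A X] inside_subset[of \<phi> B X]
      by (metis card_Un_disjoint disjoint_iff finite_inside subsetD)
  qed
  have "card (inside \<phi> (A \<union> B) X) + (k + m) \<le> (k + m) * card X" if "X \<subseteq> V" "X \<noteq> {}" for X
    using sparseD[OF baseD(2)[OF A] that] sparseD[OF baseD(2)[OF B] that]
    by (simp add: card distrib_right)
  then show ?thesis
    using baseD(1,3)[OF A] baseD(1,3)[OF B]
    by (auto simp: base_def graph_on_def sparse_def tight_def card distrib_right)
qed

section \<open>Walks, connectedness and spanning trees\<close>

lemma walk_singleton: "walk G [u] es \<longleftrightarrow> u \<in> verts G \<and> es = []"
  by (auto simp: walk_def)

lemma walk_Cons:
  "walk G (u # v # vs) (e # es) \<longleftrightarrow>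
     u \<in> verts G \<and> e \<in> edges G \<and> ends G e = {u, v} \<and> walk G (v # vs) es"
proof -
  have "(\<forall>i<length (e # es). ends G ((e # es) ! i) = {(u # v # vs) ! i, (u # v # vs) ! Suc i}) \<longleftrightarrow>
    ends G e = {u, v} \<and> (\<forall>i<length es. ends G (es ! i) = {(v # vs) ! i, (v # vs) ! Suc i})"
    by (simp add: All_less_Suc2)
  then show ?thesis by (auto simp: walk_def)
qed

text \<open>Replaces the indexed definition by peeling off the first edge.\<close>

lemma walk_induct [consumes 1, case_names single Cons]:
  assumes "walk G vs es"
    and "\<And>u. u \<in> verts G \<Longrightarrow> P [u] []"
    and "\<And>u v vs e es. u \<in> verts G \<Longrightarrow> e \<in> edges G \<Longrightarrow> ends G e = {u, v} \<Longrightarrow> walk G (v # vs) es \<Longrightarrow>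
      P (v # vs) es \<Longrightarrow> P (u # v # vs) (e # es)"
  shows "P vs es"
  using assms(1)
proof (induction vs arbitrary: es)
  case Nil
  then show ?case by (simp add: walk_def)
next
  case (Cons u vs)
  show ?case
  proof (cases vs)
    case Nil
    then show ?thesis using Cons.prems assms(2) by (simp add: walk_singleton)
  next
    case (Cons v vs')
    moreover obtain e es' where "es = e # es'"
      using Cons.prems Cons by (cases es) (auto simp: walk_def)
    ultimately show ?thesis
      using Cons.prems Cons.IH[of es'] assms(3)[of u e v vs' es'] by (simp add: walk_Cons)
  qed
qed

lemma walk_snoc:
  assumes "walk G vs es" "e \<in> edges G" "ends G e = {last vs, w}" "w \<in> verts G"
  shows "walk G (vs @ [w]) (es @ [e])"
  using assms
proof (induction rule: walk_induct)
  case (single u)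
  then show ?case by (simp add: walk_Cons walk_singleton)
next
  case (Cons u v vs e' es)
  then show ?case by (simp add: walk_Cons)
qed

lemma walk_ends:
  "walk G vs es \<Longrightarrow> e \<in> set es \<Longrightarrow> ends G e \<subseteq> set vs"
  by (induction rule: walk_induct) auto

lemma walk_crosses:
  assumes "walk G vs es" "hd vs \<in> Z" "last vs \<notin> Z"
  shows "\<exists>e\<in>edges G. ends G e \<inter> Z \<noteq> {} \<and> ends G e \<inter> (verts G - Z) \<noteq> {}"
  using assms
proof (induction rule: walk_induct)
  case (Cons u v vs e es)
  have "v \<in> verts G" using Cons.hyps(4) by (simp add: walk_def)
  then show ?case using Cons by (cases "v \<in> Z") auto
qed simp

text \<open>A walk from one side of a cut to the other contains a crossing edge. Conversely, no edge
  can leave the set of vertices reachable from \<open>u\<close>, because the walk could be prolonged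
  along it.\<close>

lemma connected_graph_iff_cut_connected:
  assumes G: "graph_on (ends G) (verts G) (edges G)"
  shows "connected_graph G \<longleftrightarrow> cut_connected (ends G) (verts G) (edges G)"
proof
  assume con: "connected_graph G"
  show "cut_connected (ends G) (verts G) (edges G)"
    unfolding cut_connected_def
  proof (intro conjI allI impI)
    show "verts G \<noteq> {}" using con by (simp add: connected_graph_def)
    fix Z assume Z: "Z \<subseteq> verts G" "Z \<noteq> {}" "Z \<noteq> verts G"
    then obtain u v where uv: "u \<in> Z" "u \<in> verts G" "v \<in> verts G" "v \<notin> Z" by blast
    then obtain vs es where "walk G vs es" "hd vs = u" "last vs = v"
      using con unfolding connected_graph_def by blast
    then show "\<exists>e\<in>edges G. ends G e \<inter> Z \<noteq> {} \<and> ends G e \<inter> (verts G - Z) \<noteq> {}"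
      using walk_crosses[of G vs es Z] uv by simp
  qed
next
  assume con: "cut_connected (ends G) (verts G) (edges G)"
  have "\<exists>vs es. walk G vs es \<and> hd vs = u \<and> last vs = v" if "u \<in> verts G" "v \<in> verts G" for u v
  proof -
    define Z where "Z = {w \<in> verts G. \<exists>vs es. walk G vs es \<and> hd vs = u \<and> last vs = w}"
    have "u \<in> Z" unfolding Z_def using \<open>u \<in> verts G\<close>
      by (intro CollectI conjI exI[of _ "[u]"] exI[of _ "[]"]) (simp_all add: walk_singleton)
    have "Z = verts G"
    proof (rule ccontr)
      assume "Z \<noteq> verts G"
      obtain e where e: "e \<in> edges G" "ends G e \<inter> Z \<noteq> {}" "ends G e \<inter> (verts G - Z) \<noteq> {}"
      proof (rule cut_connectedD[OF con, of Z])
        show "Z \<subseteq> verts G" by (auto simp: Z_def)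
      qed (use \<open>u \<in> Z\<close> \<open>Z \<noteq> verts G\<close> in auto)
      obtain a where a: "a \<in> ends G e" "a \<in> Z" using e(2) by blast
      obtain b where b: "ends G e = {a, b}" using other_end[OF G e(1) a(1)] .
      then have "b \<in> verts G - Z" using e(3) a(2) by auto
      obtain vs es where w: "walk G vs es" "hd vs = u" "last vs = a"
        using a(2) unfolding Z_def by blast
      have "walk G (vs @ [b]) (es @ [e])"
        using walk_snoc[OF w(1) e(1)] b w(3) \<open>b \<in> verts G - Z\<close> by blast
      moreover have "vs \<noteq> []" using w(1) by (auto simp: walk_def)
      ultimately have "b \<in> Z" unfolding Z_def
        using w(2) \<open>b \<in> verts G - Z\<close>
        by (intro CollectI conjI exI[of _ "vs @ [b]"] exI[of _ "es @ [e]"]) simp_all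
      then show False using \<open>b \<in> verts G - Z\<close> by blast
    qed
    then show ?thesis using \<open>v \<in> verts G\<close> unfolding Z_def by blast
  qed
  then show "connected_graph G"
    using con by (simp add: connected_graph_def cut_connected_def)
qed

text \<open>A cycle has as many edges as vertices, one more than sparsity permits inside its vertex
  set.\<close>

lemma base_1_acyclic:
  assumes T: "base 1 (ends G) (verts G) (edges G)"
  shows "\<not> cycle G vs es"
proof
  assume "cycle G vs es"
  then have w: "walk G vs es" and es: "distinct es" "es \<noteq> []" and vs: "hd vs = last vs" "distinct (tl vs)"
    by (auto simp: cycle_def closed_trail_def)
  have len: "length vs = Suc (length es)" using w by (simp add: walk_def)
  then obtain u ws where vs_eq: "vs = u # ws" by (cases vs) auto
  have ws: "ws \<noteq> []" using es(2) len vs_eq by auto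
  have "set vs = set (tl vs)" using vs(1) vs_eq ws by auto
  then have card: "card (set vs) = card (set es)"
    using vs(2) es(1) len by (simp add: distinct_card)
  have "set es \<subseteq> inside (ends G) (edges G) (set vs)"
    using walk_ends[OF w] w by (auto simp: inside_def walk_def)
  then have "card (set es) \<le> card (inside (ends G) (edges G) (set vs))"
    using baseD(4)[OF T] by (intro card_mono finite_inside)
  moreover have "card (inside (ends G) (edges G) (set vs)) + 1 \<le> 1 * card (set vs)"
    by (rule sparseD[OF baseD(2)[OF T]]) (use w vs_eq in \<open>auto simp: walk_def\<close>)
  ultimately show False using card by simp
qed

lemma cut_tree_spanning_tree:
  assumes G: "graph_on (ends G) (verts G) (edges G)" and T: "T \<subseteq> edges G" "cut_tree (ends G) (verts G) T"
  shows "spanning_tree G T"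
proof -
  have gT: "graph_on (ends G) (verts G) T"
    using G T(1) by (auto simp: graph_on_def intro: finite_subset)
  have "connected_graph (G\<lparr>edges := T\<rparr>)"
    using connected_graph_iff_cut_connected[of "G\<lparr>edges := T\<rparr>"] gT T(2) by (simp add: cut_tree_def)
  moreover have "\<not> cycle (G\<lparr>edges := T\<rparr>) vs es" for vs es
    by (rule base_1_acyclic) (use cut_tree_base[OF gT T(2)] in simp)
  ultimately show ?thesis using T(1) by (simp add: spanning_tree_def tree_def)
qed

text \<open>From left to right, the sparsity bounds of two disjoint trees add up. The converse is
  \<open>base_two_trees\<close>.\<close>

lemma tree_connected_2_iff:
  assumes G: "graph_on (ends G) (verts G) (edges G)"
  shows "tree_connected 2 G \<longleftrightarrow> (\<exists>F\<subseteq>edges G. base 2 (ends G) (verts G) F)"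
proof
  assume "tree_connected 2 G"
  then obtain T where T: "\<And>i. i < 2 \<Longrightarrow> spanning_tree G (T i)"
    "\<And>i j. i < 2 \<Longrightarrow> j < 2 \<Longrightarrow> i \<noteq> j \<Longrightarrow> T (i :: nat) \<inter> T j = {}"
    unfolding tree_connected_def by blast
  have "\<exists>B\<subseteq>T i. base 1 (ends G) (verts G) B" if "i < 2" for i :: nat
  proof -
    have sub: "T i \<subseteq> edges G" and con: "connected_graph (G\<lparr>edges := T i\<rparr>)"
      using T(1)[OF that] by (simp_all add: spanning_tree_def tree_def)
    have gT: "graph_on (ends G) (verts G) (T i)"
      using G sub by (auto simp: graph_on_def intro: finite_subset)
    have "cut_connected (ends G) (verts G) (T i)"
      using connected_graph_iff_cut_connected[of "G\<lparr>edges := T i\<rparr>"] gT con by simp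
    then show ?thesis using cut_connected_base[OF gT] by blast
  qed
  from this[of 0] this[of 1] obtain A B where
    A: "A \<subseteq> T 0" "base 1 (ends G) (verts G) A" and B: "B \<subseteq> T 1" "base 1 (ends G) (verts G) B"
    by auto
  have "A \<inter> B = {}" using A(1) B(1) T(2)[of 0 1] by auto
  then have "base 2 (ends G) (verts G) (A \<union> B)"
    using base_Un[OF A(2) B(2)] by (simp add: numeral_2_eq_2)
  moreover have "A \<union> B \<subseteq> edges G"
    using A(1) B(1) T(1)[of 0] T(1)[of 1] by (auto simp: spanning_tree_def)
  ultimately show "\<exists>F\<subseteq>edges G. base 2 (ends G) (verts G) F" by blast
next
  assume "\<exists>F\<subseteq>edges G. base 2 (ends G) (verts G) F"
  then obtain F T1 T2 where F: "F \<subseteq> edges G" and T: "T1 \<subseteq> F" "T2 \<subseteq> F" "T1 \<inter> T2 = {}"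
    "cut_tree (ends G) (verts G) T1" "cut_tree (ends G) (verts G) T2"
    using base_two_trees by metis
  have "spanning_tree G T1" "spanning_tree G T2"
    using cut_tree_spanning_tree[OF G] F T by (metis order_trans)+
  then show "tree_connected 2 G"
    unfolding tree_connected_def using T(3)
    by (intro exI[of _ "\<lambda>i. if i = 0 then T1 else T2"]) (auto simp: less_2_cases_iff)
qed

section \<open>Spanning closed trails in even subgraphs\<close>

text \<open>Edge sets under symmetric difference form a vector space over the field with two
  elements, and degree parity is linear on it.\<close>

lemma odd_degree_sym_diff:
  assumes "finite A" "finite B"
  shows "odd (degree \<phi> ((A - B) \<union> (B - A)) v) \<longleftrightarrow> odd (degree \<phi> A v) \<noteq> odd (degree \<phi> B v)"
proof -
  define A' B' where "A' = {e \<in> A. v \<in> \<phi> e}" and "B' = {e \<in> B. v \<in> \<phi> e}"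
  have fin: "finite A'" "finite B'" using assms by (simp_all add: A'_def B'_def)
  have eq: "{e \<in> (A - B) \<union> (B - A). v \<in> \<phi> e} = (A' - B') \<union> (B' - A')"
    by (auto simp: A'_def B'_def)
  have "card ((A' - B') \<union> (B' - A')) = card (A' - B') + card (B' - A')"
    by (rule card_Un_disjoint) (use fin in auto)
  moreover have "card A' = card (A' - B') + card (A' \<inter> B')" "card B' = card (B' - A') + card (A' \<inter> B')"
    using card_Int_Diff[OF fin(1), of B'] card_Int_Diff[OF fin(2), of A'] by (simp_all add: Int_commute)
  ultimately show ?thesis
    unfolding degree_def eq A'_def[symmetric] B'_def[symmetric] by auto
qed

text \<open>Plays the role of a path from \<open>u\<close> to \<open>w\<close>; for
  \<open>u = w\<close> the join has no odd vertex. The set of vertices \<open>w\<close> that can be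
  served contains \<open>u\<close>, and toggling a crossing edge \<open>ab\<close> moves the second
  odd vertex from \<open>a\<close> to \<open>b\<close>, so no cut stops it.\<close>

lemma pair_join:
  assumes T: "graph_on \<phi> V T" "cut_connected \<phi> V T" and uw: "u \<in> V" "w \<in> V"
  shows "\<exists>J\<subseteq>T. \<forall>v. odd (degree \<phi> J v) \<longleftrightarrow> (v = u) \<noteq> (v = w)"
proof -
  define Z where "Z = {w \<in> V. \<exists>J\<subseteq>T. \<forall>v. odd (degree \<phi> J v) \<longleftrightarrow> (v = u) \<noteq> (v = w)}"
  have "u \<in> Z" unfolding Z_def using uw(1) by (auto simp: degree_def intro!: exI[of _ "{}"])
  have "Z = V"
  proof (rule ccontr)
    assume "Z \<noteq> V"
    obtain e where e: "e \<in> T" "\<phi> e \<inter> Z \<noteq> {}" "\<phi> e \<inter> (V - Z) \<noteq> {}"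
    proof (rule cut_connectedD[OF T(2), of Z])
      show "Z \<subseteq> V" by (auto simp: Z_def)
    qed (use \<open>u \<in> Z\<close> \<open>Z \<noteq> V\<close> in auto)
    obtain a where a: "a \<in> \<phi> e" "a \<in> Z" using e(2) by blast
    obtain b where b: "\<phi> e = {a, b}" "b \<in> V" "b \<noteq> a" using other_end[OF T(1) e(1) a(1)] .
    have "b \<notin> Z" using e(3) a(2) b(1) by auto
    obtain J where J: "J \<subseteq> T" "\<And>v. odd (degree \<phi> J v) \<longleftrightarrow> (v = u) \<noteq> (v = a)"
      using a(2) unfolding Z_def by blast
    have "finite J" using J(1) T(1) by (auto simp: graph_on_def intro: finite_subset)
    have "degree \<phi> {e} v = (if v = a \<or> v = b then 1 else 0)" for v
    proof -
      have "{e' \<in> {e}. v \<in> \<phi> e'} = (if v = a \<or> v = b then {e} else {})" using b(1) by auto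
      then show ?thesis by (simp add: degree_def)
    qed
    then have "odd (degree \<phi> ((J - {e}) \<union> ({e} - J)) v) \<longleftrightarrow> (v = u) \<noteq> (v = b)" for v
      using odd_degree_sym_diff[OF \<open>finite J\<close>, of "{e}" \<phi> v] J(2)[of v] b(3) by auto
    moreover have "(J - {e}) \<union> ({e} - J) \<subseteq> T" using J(1) e(1) by blast
    ultimately have "b \<in> Z" unfolding Z_def using b(2) by blast
    then show False using \<open>b \<notin> Z\<close> by blast
  qed
  then show ?thesis using uw(2) unfolding Z_def by blast
qed

text \<open>Pair off the vertices of \<open>R\<close> and add the joins of the pairs modulo
  two.\<close>

lemma exists_join:
  assumes T: "graph_on \<phi> V T" "cut_connected \<phi> V T" and R: "R \<subseteq> V" "even (card R)"
  shows "\<exists>J\<subseteq>T. \<forall>v. odd (degree \<phi> J v) \<longleftrightarrow> v \<in> R"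
  using R
proof (induction "card R" arbitrary: R rule: less_induct)
  case less
  have fin: "finite R" using less.prems(1) T(1) by (auto simp: graph_on_def intro: finite_subset)
  show ?case
  proof (cases "R = {}")
    case True
    then show ?thesis by (auto simp: degree_def intro!: exI[of _ "{}"])
  next
    case False
    then obtain u where u: "u \<in> R" by blast
    have "R \<noteq> {u}" using less.prems(2) by auto
    then obtain w where w: "w \<in> R" "w \<noteq> u" using u by blast
    have "card (R - {u, w}) + 2 = card R"
      using u w fin card_mono[of R "{u, w}"] by (simp add: card_Diff_subset)
    then have "card (R - {u, w}) < card R" "even (card (R - {u, w}))"
      using less.prems(2) by presburger+
    then have "\<exists>J\<subseteq>T. \<forall>v. odd (degree \<phi> J v) \<longleftrightarrow> v \<in> R - {u, w}"
      using less.hyps[of "R - {u, w}"] less.prems(1) by blast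
    then obtain J where J: "J \<subseteq> T" "\<And>v. odd (degree \<phi> J v) \<longleftrightarrow> v \<in> R - {u, w}" by blast
    obtain J' where J': "J' \<subseteq> T" "\<And>v. odd (degree \<phi> J' v) \<longleftrightarrow> (v = u) \<noteq> (v = w)"
      using pair_join[OF T, of u w] u w less.prems(1) by blast
    have "finite J" "finite J'"
      using J(1) J'(1) T(1) by (auto simp: graph_on_def intro: finite_subset)
    then have "odd (degree \<phi> ((J - J') \<union> (J' - J)) v) \<longleftrightarrow> v \<in> R" for v
      using odd_degree_sym_diff[of J J' \<phi> v] J(2)[of v] J'(2)[of v] u w by auto
    moreover have "(J - J') \<union> (J' - J) \<subseteq> T" using J(1) J'(1) by blast
    ultimately show ?thesis by blast
  qed
qed

text \<open>\<open>T1\<close> provides connectedness. By the handshake lemma it has an even number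
  of odd vertices, so \<open>T2\<close> contains a join correcting all parities.\<close>

lemma connected_even_subgraph:
  assumes F: "base 2 \<phi> V F"
  obtains K where "K \<subseteq> F" "cut_connected \<phi> V K" "\<And>v. even (degree \<phi> K v)"
proof -
  obtain T1 T2 where T: "T1 \<subseteq> F" "T2 \<subseteq> F" "T1 \<inter> T2 = {}" "cut_tree \<phi> V T1" "cut_tree \<phi> V T2"
    using base_two_trees[OF F] by blast
  have gr: "graph_on \<phi> V T" if "T \<subseteq> F" for T
    using baseD(1)[OF F] that by (auto simp: graph_on_def intro: finite_subset)
  define R where "R = {v \<in> V. odd (degree \<phi> T1 v)}"
  have "even (\<Sum>v\<in>V. degree \<phi> T1 v)" using handshake[OF gr[OF T(1)]] by simp
  then have "even (card R)"
    unfolding R_def using baseD(5)[OF F] by (simp add: even_sum_iff)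
  then obtain J where J: "J \<subseteq> T2" "\<And>v. odd (degree \<phi> J v) \<longleftrightarrow> v \<in> R"
    using exists_join[OF gr[OF T(2)], of R] T(5) unfolding R_def cut_tree_def by blast
  have fin: "finite T1" "finite J"
    using gr[OF T(1)] gr[of J] J(1) T(2) by (auto simp: graph_on_def)
  have out: "degree \<phi> T1 v = 0" if "v \<notin> V" for v
    using gr[OF T(1)] that by (auto simp: degree_def graph_on_def)
  have "degree \<phi> (T1 \<union> J) v = degree \<phi> T1 v + degree \<phi> J v" for v
  proof -
    have "{e \<in> T1 \<union> J. v \<in> \<phi> e} = {e \<in> T1. v \<in> \<phi> e} \<union> {e \<in> J. v \<in> \<phi> e}" by blast
    then show ?thesis
      unfolding degree_def using fin T(3) J(1) by (simp, intro card_Un_disjoint) auto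
  qed
  then have "even (degree \<phi> (T1 \<union> J) v)" for v
    using J(2)[of v] out[of v] by (auto simp: R_def)
  moreover have "cut_connected \<phi> V (T1 \<union> J)"
    using T(4) unfolding cut_tree_def cut_connected_def by blast
  moreover have "T1 \<union> J \<subseteq> F" using T(1,2) J(1) by blast
  ultimately show thesis using that by blast
qed

section \<open>Closed trails from longest trails\<close>

text \<open>Every entry of the vertex list has a trail edge before it and one after it, except that
  the first entry lacks the former and the last lacks the latter; the two correction terms supply
  these.\<close>

lemma trail_degree:
  assumes "walk G vs es" and "distinct es" and "\<And>e. e \<in> edges G \<Longrightarrow> card (ends G e) = 2"
  shows "degree (ends G) (set es) v + of_bool (v = hd vs) + of_bool (v = last vs) = 2 * count_list vs v"
  using assms
proof (induction rule: walk_induct)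
  case (single u)
  then show ?case by (simp add: degree_def)
next
  case (Cons u w vs e es)
  have "u \<noteq> w" using Cons.prems(2)[OF Cons.hyps(2)] Cons.hyps(3) by auto
  have "{a \<in> set (e # es). v \<in> ends G a}
      = (if v = u \<or> v = w then insert e {a \<in> set es. v \<in> ends G a} else {a \<in> set es. v \<in> ends G a})"
    using Cons.hyps(3) by auto
  then have "degree (ends G) (set (e # es)) v
      = degree (ends G) (set es) v + of_bool (v = u) + of_bool (v = w)"
    using Cons.prems(1) \<open>u \<noteq> w\<close> unfolding degree_def by (auto simp: card_insert_if)
  then show ?case using Cons.IH Cons.prems \<open>u \<noteq> w\<close> by auto
qed

text \<open>Moving the first edge to the end brings every vertex one position forward. The dropped
  first vertex is still present as the old last one.\<close>

lemma closed_trail_rotate: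
  assumes "closed_trail G vs es" "a \<in> set vs"
  shows "\<exists>vs' es'. closed_trail G vs' es' \<and> hd vs' = a \<and> set vs' = set vs \<and> set es' = set es"
proof -
  obtain n where "n < length vs" "vs ! n = a" using assms(2) by (auto simp: in_set_conv_nth)
  then show ?thesis
    using assms(1)
  proof (induction n arbitrary: vs es)
    case 0
    then show ?case by (metis hd_conv_nth length_greater_0_conv)
  next
    case (Suc n)
    have len: "length vs = Suc (length es)" using Suc.prems(3) by (simp add: closed_trail_def walk_def)
    obtain u ws where "vs = u # ws" using len by (cases vs) auto
    moreover obtain w ws' where "ws = w # ws'" using Suc.prems(1) calculation by (cases ws) auto
    moreover obtain e es' where "es = e # es'" using len calculation by (cases es) auto
    ultimately have vs: "vs = u # w # ws'" and es: "es = e # es'" by auto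
    have w: "u \<in> verts G" "e \<in> edges G" "ends G e = {u, w}" "walk G (w # ws') es'"
      and dist: "distinct es" and closed: "last (w # ws') = u"
      using Suc.prems(3) unfolding closed_trail_def vs es walk_Cons by auto
    have "w \<in> verts G" using w(4) by (simp add: walk_def)
    then have "walk G ((w # ws') @ [w]) (es' @ [e])"
      using walk_snoc[OF w(4,2)] w(3) closed by simp
    then have "closed_trail G ((w # ws') @ [w]) (es' @ [e])"
      using dist by (simp add: closed_trail_def es)
    moreover have "n < length ((w # ws') @ [w])" "((w # ws') @ [w]) ! n = a"
      using Suc.prems(1,2) vs nth_append[of "w # ws'" "[w]" n] by auto
    moreover have "set ((w # ws') @ [w]) = set vs"
      using closed last_in_set[of "w # ws'"] by (auto simp: vs)
    moreover have "set (es' @ [e]) = set es" by (simp add: es)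
    ultimately show ?case using Suc.IH by metis
  qed
qed

text \<open>A longest trail in \<open>K\<close> is closed by parity. If it missed a vertex, an edge
  of \<open>K\<close> would leave its vertex set, and the trail rotated to end there could be
  prolonged.\<close>

lemma spanning_closed_trail:
  assumes G: "graph_on (ends G) (verts G) (edges G)" and K: "K \<subseteq> edges G"
    and con: "cut_connected (ends G) (verts G) K" and even: "\<And>v. even (degree (ends G) K v)"
  shows "\<exists>vs es. closed_trail G vs es \<and> set vs = verts G \<and> set es \<subseteq> K"
proof -
  have finK: "finite K" using G K by (auto simp: graph_on_def intro: finite_subset)
  define trail where "trail p \<longleftrightarrow> walk G (fst p) (snd p) \<and> distinct (snd p) \<and> set (snd p) \<subseteq> K" for p
  have bound: "\<forall>p. trail p \<longrightarrow> length (snd p) < Suc (card K)"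
    using finK by (auto simp: trail_def less_Suc_eq_le distinct_card[symmetric] card_mono)
  obtain u where "u \<in> verts G" using con by (auto simp: cut_connected_def)
  then have "trail ([u], [])" by (simp add: trail_def walk_singleton)
  then obtain p where "trail p" and max: "\<And>q. trail q \<Longrightarrow> length (snd q) \<le> length (snd p)"
    using ex_has_greatest_nat[of trail _ "\<lambda>p. length (snd p)", OF _ bound] by blast
  obtain vs es where p: "p = (vs, es)" by fastforce
  have w: "walk G vs es" and es: "distinct es" "set es \<subseteq> K"
    using \<open>trail p\<close> by (simp_all add: trail_def p)
  have loopless: "card (ends G e) = 2" if "e \<in> edges G" for e
    using G that by (simp add: graph_on_def)
  \<comment> \<open>Stated for every trail with the same edge set, so that it also covers rotations
    of the chosen trail.\<close>
  have stuck: False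
    if w': "walk G vs' es'" "distinct es'" "set es' = set es" and e: "e \<in> K - set es" "last vs' \<in> ends G e"
    for vs' es' e
  proof -
    obtain b where b: "ends G e = {last vs', b}" "b \<in> verts G"
      using other_end[OF G _ e(2)] e(1) K by blast
    have "walk G (vs' @ [b]) (es' @ [e])"
      by (rule walk_snoc[OF w'(1) _ b]) (use e(1) K in blast)
    then have "trail (vs' @ [b], es' @ [e])"
      using w'(2,3) e(1) es(2) by (simp add: trail_def)
    then have "length es' < length es" using max[of "(vs' @ [b], es' @ [e])"] by (simp add: p)
    then show False using w'(2,3) es(1) by (metis distinct_card less_irrefl)
  qed
  have closed: "hd vs = last vs"
  proof (rule ccontr)
    assume "hd vs \<noteq> last vs"
    then have "degree (ends G) (set es) (last vs) + 1 = 2 * count_list vs (last vs)"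
      using trail_degree[OF w es(1) loopless, of "last vs"] by simp
    \<comment> \<open>At an end that is not also the start, the trail uses an odd number of edges;
      \<open>K\<close> has an even number there, so one is left over.\<close>
    then have "odd (degree (ends G) (set es) (last vs))" by (metis dvd_triv_left even_plus_one_iff)
    then have "degree (ends G) (set es) (last vs) \<noteq> degree (ends G) K (last vs)"
      using even by metis
    then have "{e \<in> set es. last vs \<in> ends G e} \<noteq> {e \<in> K. last vs \<in> ends G e}"
      by (auto simp: degree_def)
    then obtain e where "e \<in> K - set es" "last vs \<in> ends G e" using es(2) by blast
    then show False using stuck[OF w es(1)] by blast
  qed
  have vs: "vs \<noteq> []" "set vs \<subseteq> verts G" using w by (auto simp: walk_def)
  have "set vs = verts G"
  proof (rule ccontr)
    assume ne: "set vs \<noteq> verts G"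
    obtain e where e: "e \<in> K" "ends G e \<inter> set vs \<noteq> {}" "ends G e \<inter> (verts G - set vs) \<noteq> {}"
      by (rule cut_connectedD[OF con vs(2) _ ne]) (use vs(1) in auto)
    have "e \<notin> set es" using e(3) walk_ends[OF w] by blast
    obtain a where a: "a \<in> ends G e" "a \<in> set vs" using e(2) by blast
    have "closed_trail G vs es" using w es(1) closed by (simp add: closed_trail_def)
    then obtain vs' es' where "closed_trail G vs' es'" "hd vs' = a" "set es' = set es"
      using closed_trail_rotate[OF _ a(2)] by blast
    then show False
      using stuck[of vs' es' e] e(1) \<open>e \<notin> set es\<close> a(1) by (simp add: closed_trail_def)
  qed
  then show ?thesis using w es closed by (auto simp: closed_trail_def)
qed

text \<open>A closed trail uses two edges per visit, so a degree bound of \<open>2 * k + 1\<close>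
  allows only \<open>k\<close> visits. The trivial trail makes one visit without an edge, and there
  \<open>k > 0\<close> is used.\<close>

lemma visits_le:
  assumes t: "closed_trail G vs es" and G: "\<And>e. e \<in> edges G \<Longrightarrow> card (ends G e) = 2"
    and F: "set es \<subseteq> F" "finite F" and deg: "degree (ends G) F v \<le> 2 * k + 1" and k: "k > 0"
  shows "visits vs v \<le> k"
proof (cases "length vs = 1")
  case True
  then obtain u where "vs = [u]" by (auto simp: length_Suc_conv)
  then show ?thesis using k by (simp add: visits_def)
next
  case False
  have w: "walk G vs es" "distinct es" "hd vs = last vs" using t by (simp_all add: closed_trail_def)
  have "vs \<noteq> []" using w(1) by (auto simp: walk_def)
  then have "count_list vs v = of_bool (v = hd vs) + count_list (tl vs) v" by (cases vs) auto
  then have "degree (ends G) (set es) v = 2 * count_list (tl vs) v"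
    using trail_degree[OF w(1,2) G, of v] w(3) by (auto split: if_splits)
  moreover have "degree (ends G) (set es) v \<le> degree (ends G) F v"
    unfolding degree_def using F by (intro card_mono) auto
  ultimately show ?thesis using deg False by (simp add: visits_def)
qed

section \<open>Tree components from tight sets\<close>

lemma card_inside_Union:
  assumes Q: "finite Q" "pairwise disjnt Q" and F: "finite F" "\<And>e. e \<in> F \<Longrightarrow> \<phi> e \<noteq> {}"
  shows "card (inside \<phi> F (\<Union>Q)) = (\<Sum>X\<in>Q. card (inside \<phi> F X)) +
    card {e \<in> F. \<phi> e \<subseteq> \<Union>Q \<and> \<not> (\<exists>X\<in>Q. \<phi> e \<subseteq> X)}"
proof -
  let ?K = "{e \<in> F. \<phi> e \<subseteq> \<Union>Q \<and> \<not> (\<exists>X\<in>Q. \<phi> e \<subseteq> X)}"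
  have "inside \<phi> F (\<Union>Q) = (\<Union>X\<in>Q. inside \<phi> F X) \<union> ?K"
    by (auto simp: inside_def)
  moreover have "card ((\<Union>X\<in>Q. inside \<phi> F X) \<union> ?K) = card (\<Union>X\<in>Q. inside \<phi> F X) + card ?K"
    by (rule card_Un_disjoint) (use Q(1) F(1) in \<open>auto simp: inside_def\<close>)
  moreover have "card (\<Union>X\<in>Q. inside \<phi> F X) = (\<Sum>X\<in>Q. card (inside \<phi> F X))"
  proof (rule card_UN_disjoint[OF Q(1)])
    show "\<forall>X\<in>Q. \<forall>Y\<in>Q. X \<noteq> Y \<longrightarrow> inside \<phi> F X \<inter> inside \<phi> F Y = {}"
    proof (intro ballI impI)
      fix X Y assume "X \<in> Q" "Y \<in> Q" "X \<noteq> Y"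
      then have "X \<inter> Y = {}" using Q(2) by (auto simp: pairwise_def disjnt_def)
      then show "inside \<phi> F X \<inter> inside \<phi> F Y = {}"
        using F(2) unfolding inside_def by blast
    qed
  qed (use F(1) in \<open>auto intro: finite_inside\<close>)
  ultimately show ?thesis by simp
qed

lemma graph_on_nonempty: "graph_on \<phi> V F \<Longrightarrow> e \<in> F \<Longrightarrow> \<phi> e \<noteq> {}"
  by (auto simp: graph_on_def)

lemma tight_comps_disjoint:
  assumes F: "graph_on \<phi> V F" "sparse m \<phi> V F" and W: "W \<subseteq> V"
  shows "pairwise disjnt (tight_comp m \<phi> F W ` W)"
  unfolding pairwise_def disjnt_def
proof (intro ballI impI)
  fix X Y assume X: "X \<in> tight_comp m \<phi> F W ` W" and Y: "Y \<in> tight_comp m \<phi> F W ` W" and "X \<noteq> Y"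
  show "X \<inter> Y = {}"
  proof (rule ccontr)
    assume "X \<inter> Y \<noteq> {}"
    then obtain z where z: "z \<in> X" "z \<in> Y" by blast
    then have "tight_comp m \<phi> F W z = X" "tight_comp m \<phi> F W z = Y"
      using X Y tight_comp_eq[OF F W] by blast+
    then show False using \<open>X \<noteq> Y\<close> by simp
  qed
qed

lemma base_inside:
  assumes "graph_on \<phi> V F" "sparse m \<phi> V F" "X \<subseteq> V" "tight m \<phi> F X"
  shows "base m \<phi> X (inside \<phi> F X)"
proof -
  have eq: "inside \<phi> (inside \<phi> F X) Y = inside \<phi> F Y" if "Y \<subseteq> X" for Y
    using that by (auto simp: inside_def)
  have "graph_on \<phi> X (inside \<phi> F X)"
    using assms(1,3) by (auto simp: graph_on_def inside_def intro: finite_subset)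
  then show ?thesis
    using assms(2-4) by (auto simp: base_def sparse_def tight_def eq)
qed

lemma graph_on_induced:
  assumes "graph_on (ends G) (verts G) (edges G)" "X \<subseteq> verts G"
  shows "graph_on (ends (induced G X)) (verts (induced G X)) (edges (induced G X))"
  using assms by (auto simp: induced_def graph_on_def intro: finite_subset)

lemma tree_connected_2_induced:
  assumes G: "graph_on (ends G) (verts G) (edges G)" and X: "X \<subseteq> verts G"
  shows "tree_connected 2 (induced G X) \<longleftrightarrow>
    (\<exists>B\<subseteq>inside (ends G) (edges G) X. base 2 (ends G) X B)"
  using tree_connected_2_iff[OF graph_on_induced[OF G X]] by (simp add: induced_def inside_def)

section \<open>Components when every edge outside the sparse set lies in a tight set\<close>

text \<open>This is the situation that a barrier \<open>S\<close> creates in the graph without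
  \<open>S\<close>. It lets \<open>Omega\<close> be computed from vertex and edge counts
  alone.\<close>

locale covered_base =
  fixes G :: "('v, 'e) multigraph" and F :: "'e set"
  assumes G: "graph_on (ends G) (verts G) (edges G)"
    and F_edges: "F \<subseteq> edges G"
    and sparse: "sparse 2 (ends G) (verts G) F"
    and cover: "\<And>e. e \<in> edges G - F \<Longrightarrow> \<exists>X\<subseteq>verts G. tight 2 (ends G) F X \<and> ends G e \<subseteq> X"
begin

abbreviation comp :: "'v \<Rightarrow> 'v set" where
  "comp \<equiv> tight_comp 2 (ends G) F (verts G)"

lemma F_graph: "graph_on (ends G) (verts G) F"
  using G F_edges by (auto simp: graph_on_def intro: finite_subset)

lemma finite_F: "finite F" and finite_verts: "finite (verts G)"
  using F_graph by (auto simp: graph_on_def)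

lemma comp_tight: "u \<in> verts G \<Longrightarrow> tight 2 (ends G) F (comp u)"
  and mem_comp: "u \<in> verts G \<Longrightarrow> u \<in> comp u"
  using tight_comp[OF F_graph sparse _ order_refl] by auto

lemma comp_subset: "comp u \<subseteq> verts G"
  by (rule tight_comp_subset)

lemma finite_comp: "finite (comp u)"
  using comp_subset finite_verts by (rule finite_subset)

lemma cover_comp:
  assumes "e \<in> edges G - F" "u \<in> ends G e"
  shows "ends G e \<subseteq> comp u"
proof -
  obtain X where X: "X \<subseteq> verts G" "tight 2 (ends G) F X" "ends G e \<subseteq> X"
    using cover[OF assms(1)] by blast
  then have "X \<subseteq> comp u" using assms(2) by (intro tight_comp_maximal) auto
  then show ?thesis using X(3) by blast
qed

lemma disjoint_comps: "pairwise disjnt (comp ` Y)" if "Y \<subseteq> verts G"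
  using tight_comps_disjoint[OF F_graph sparse order_refl] image_mono[OF that] by (rule pairwise_subset)

lemma sum_inside_comps:
  assumes Y: "Y \<subseteq> verts G"
  shows "(\<Sum>X\<in>comp ` Y. card (inside (ends G) F X)) + 2 * card (comp ` Y) = 2 * card (\<Union>(comp ` Y))"
proof -
  have "(\<Sum>X\<in>comp ` Y. card (inside (ends G) F X)) + 2 * card (comp ` Y)
      = (\<Sum>X\<in>comp ` Y. card (inside (ends G) F X) + 2)"
    by (simp only: sum.distrib) simp
  also have "\<dots> = (\<Sum>X\<in>comp ` Y. 2 * card X)"
    by (rule sum.cong[OF refl]) (use comp_tight Y in \<open>auto simp: tight_def\<close>)
  also have "\<dots> = 2 * (\<Sum>X\<in>comp ` Y. card X)" by (rule sum_distrib_left[symmetric])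
  also have "(\<Sum>X\<in>comp ` Y. card X) = card (\<Union>(comp ` Y))"
    using card_Union_disjoint[OF disjoint_comps[OF Y]] finite_comp by force
  finally show ?thesis .
qed

text \<open>The members of \<open>Q\<close> contain at most \<open>2 * card Y - 2 * card Q\<close>
  edges of \<open>B\<close>, so at least \<open>2 * card Q - 2\<close> edges of \<open>B\<close> run
  between them. These belong to \<open>F\<close>, and together with the edges of \<open>F\<close>
  inside the members they make \<open>\<Union>Q\<close> tight. By maximality one component contains
  it.\<close>

lemma base_subset_comp:
  assumes Y: "Y \<subseteq> verts G" and B: "B \<subseteq> edges G" "base 2 (ends G) Y B" and u: "u \<in> Y"
  shows "Y \<subseteq> comp u"
proof -
  let ?i = "\<lambda>F X. inside (ends G) F X"
  define Q where "Q = comp ` Y"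
  define K where "K A = {e \<in> A. ends G e \<subseteq> \<Union>Q \<and> \<not> (\<exists>X\<in>Q. ends G e \<subseteq> X)}" for A
  have finY: "finite Y" and finB: "finite B" using baseD(4,5)[OF B(2)] by auto
  have finQ: "finite Q" using finY by (simp add: Q_def)
  have disj: "pairwise disjnt Q" unfolding Q_def by (rule disjoint_comps[OF Y])
  have YQ: "Y \<subseteq> \<Union>Q" using Y mem_comp by (auto simp: Q_def)
  have QV: "\<Union>Q \<subseteq> verts G" using comp_subset by (auto simp: Q_def)
  have Q_sparse: "card (?i B X) + 2 \<le> 2 * card (X \<inter> Y)" if "X \<in> Q" for X
  proof -
    have "?i B X = ?i B (X \<inter> Y)" using baseD(6)[OF B(2)] by (auto simp: inside_def)
    moreover have "X \<inter> Y \<noteq> {}" using that Y mem_comp by (auto simp: Q_def)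
    ultimately show ?thesis using sparseD[OF baseD(2)[OF B(2)], of "X \<inter> Y"] by simp
  qed
  \<comment> \<open>An edge outside \<open>F\<close> lies in the component of either of its ends, so
    it does not run between members of \<open>Q\<close>.\<close>
  have "K B \<subseteq> K F"
  proof
    fix e assume e: "e \<in> K B"
    have "e \<in> F"
    proof (rule ccontr)
      assume "e \<notin> F"
      have "e \<in> B" using e by (simp add: K_def)
      obtain y where y: "y \<in> ends G e" using graph_on_nonempty[OF baseD(1)[OF B(2)] \<open>e \<in> B\<close>] by blast
      then have "y \<in> Y" using baseD(6)[OF B(2) \<open>e \<in> B\<close>] by blast
      then have "comp y \<in> Q" by (simp add: Q_def)
      moreover have "ends G e \<subseteq> comp y"
        using cover_comp y \<open>e \<notin> F\<close> \<open>e \<in> B\<close> B(1) by blast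
      ultimately show False using e by (auto simp: K_def)
    qed
    then show "e \<in> K F" using e by (simp add: K_def)
  qed
  then have K_le: "card (K B) \<le> card (K F)"
    using finite_F by (intro card_mono) (auto simp: K_def)
  have "B = ?i B (\<Union>Q)" using baseD(6)[OF B(2)] YQ by (auto simp: inside_def)
  then have "card B = (\<Sum>X\<in>Q. card (?i B X)) + card (K B)"
    unfolding K_def
    using card_inside_Union[OF finQ disj finB, of "ends G"] graph_on_nonempty[OF baseD(1)[OF B(2)]]
    by simp
  moreover have "(\<Sum>X\<in>Q. card (?i B X)) + 2 * card Q \<le> 2 * card Y"
  proof -
    have "(\<Sum>X\<in>Q. card (?i B X)) + 2 * card Q = (\<Sum>X\<in>Q. card (?i B X) + 2)"
      by (simp only: sum.distrib) simp
    also have "\<dots> \<le> (\<Sum>X\<in>Q. 2 * card (X \<inter> Y))" by (rule sum_mono) (rule Q_sparse)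
    also have "\<dots> = 2 * (\<Sum>X\<in>Q. card (X \<inter> Y))" by (simp add: sum_distrib_left)
    also have "(\<Sum>X\<in>Q. card (X \<inter> Y)) = card (\<Union>X\<in>Q. X \<inter> Y)"
      by (rule card_UN_disjoint[symmetric])
        (use finQ finY disj in \<open>auto simp: pairwise_def disjnt_def\<close>)
    also have "(\<Union>X\<in>Q. X \<inter> Y) = Y" using YQ by blast
    finally show ?thesis .
  qed
  moreover have "card B + 2 = 2 * card Y"
    using baseD(1,3)[OF B(2)] by (simp add: tight_def inside_all)
  ultimately have K_ge: "2 * card Q \<le> card (K F) + 2" using K_le by linarith
  have "card (?i F (\<Union>Q)) = (\<Sum>X\<in>Q. card (?i F X)) + card (K F)"
    unfolding K_def using card_inside_Union[OF finQ disj finite_F] graph_on_nonempty[OF F_graph] by blast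
  moreover have "(\<Sum>X\<in>Q. card (?i F X)) + 2 * card Q = 2 * card (\<Union>Q)"
    unfolding Q_def by (rule sum_inside_comps[OF Y])
  moreover have "card (?i F (\<Union>Q)) + 2 \<le> 2 * card (\<Union>Q)"
    by (rule sparseD[OF sparse QV]) (use u YQ in blast)
  ultimately have "tight 2 (ends G) F (\<Union>Q)"
    using K_ge unfolding tight_def by linarith
  then have "\<Union>Q \<subseteq> comp u"
    using QV u YQ by (intro tight_comp_maximal) auto
  then show ?thesis using YQ by blast
qed

lemma tree_connected_comp:
  assumes "u \<in> verts G"
  shows "tree_connected 2 (induced G (comp u))"
proof -
  have "inside (ends G) F (comp u) \<subseteq> inside (ends G) (edges G) (comp u)"
    using F_edges by (auto simp: inside_def)
  then show ?thesis
    using base_inside[OF F_graph sparse comp_subset comp_tight[OF assms]]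
    unfolding tree_connected_2_induced[OF G comp_subset] by (intro exI conjI)
qed

lemma tree_connected_subset_comp:
  assumes "Y \<subseteq> verts G" "tree_connected 2 (induced G Y)" "u \<in> Y"
  shows "Y \<subseteq> comp u"
proof -
  obtain B where B: "B \<subseteq> inside (ends G) (edges G) Y" "base 2 (ends G) Y B"
    using assms(2) unfolding tree_connected_2_induced[OF G assms(1)] by blast
  show ?thesis
    by (rule base_subset_comp[OF assms(1) order_trans[OF B(1) inside_subset] B(2) assms(3)])
qed

lemma tree_components_eq: "tree_components 2 G = comp ` verts G"
proof (intro equalityI subsetI)
  fix X assume "X \<in> tree_components 2 G"
  then have X: "X \<subseteq> verts G" "tree_connected 2 (induced G X)"
    and max: "\<And>Y. X \<subset> Y \<Longrightarrow> Y \<subseteq> verts G \<Longrightarrow> \<not> tree_connected 2 (induced G Y)"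
    by (auto simp: tree_components_def)
  \<comment> \<open>A base on the empty set would satisfy \<open>0 + 2 = 0\<close>.\<close>
  have "X \<noteq> {}"
    using X(2) unfolding tree_connected_2_induced[OF G X(1)] base_def tight_def by auto
  then obtain u where u: "u \<in> X" by blast
  then have "u \<in> verts G" using X(1) by blast
  then have "\<not> X \<subset> comp u" using max[OF _ comp_subset] tree_connected_comp by metis
  then have "X = comp u" using tree_connected_subset_comp[OF X u] by blast
  then show "X \<in> comp ` verts G" using u X(1) by blast
next
  fix X assume "X \<in> comp ` verts G"
  then obtain u where u: "u \<in> verts G" "X = comp u" by blast
  have "\<not> tree_connected 2 (induced G Y)" if "comp u \<subset> Y" "Y \<subseteq> verts G" for Y
    using tree_connected_subset_comp[of Y u] that mem_comp[OF u(1)] by blast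
  then show "X \<in> tree_components 2 G"
    using u comp_subset tree_connected_comp by (auto simp: tree_components_def)
qed

text \<open>Edges outside \<open>F\<close> stay within one component, so all crossing edges are in
  \<open>F\<close>. The right-hand side has the form needed for
  \<open>card_inside_Union\<close>.\<close>

lemma crossing_edges_eq:
  "crossing_edges G (comp ` verts G)
    = {e \<in> F. ends G e \<subseteq> \<Union>(comp ` verts G) \<and> \<not> (\<exists>X\<in>comp ` verts G. ends G e \<subseteq> X)}"
proof (intro equalityI subsetI)
  fix e assume "e \<in> crossing_edges G (comp ` verts G)"
  then obtain X Y where e: "e \<in> edges G" and XY: "X \<in> comp ` verts G" "Y \<in> comp ` verts G" "X \<noteq> Y"
    and meet: "ends G e \<inter> X \<noteq> {}" "ends G e \<inter> Y \<noteq> {}"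
    unfolding crossing_edges_def by blast
  have disj: "Z = Z'" if "Z \<in> comp ` verts G" "Z' \<in> comp ` verts G" "Z \<inter> Z' \<noteq> {}" for Z Z'
    using disjoint_comps[OF order_refl] that unfolding pairwise_def disjnt_def by blast
  have no: "\<not> ends G e \<subseteq> Z" if Z: "Z \<in> comp ` verts G" for Z
  proof
    assume "ends G e \<subseteq> Z"
    then have "Z \<inter> X \<noteq> {}" "Z \<inter> Y \<noteq> {}" using meet by blast+
    then show False using disj Z XY by metis
  qed
  have sub: "ends G e \<subseteq> verts G" using e G by (simp add: graph_on_def)
  have "e \<in> F"
  proof (rule ccontr)
    assume "e \<notin> F"
    obtain u where u: "u \<in> ends G e" using meet(1) by blast
    then have "ends G e \<subseteq> comp u" using cover_comp e \<open>e \<notin> F\<close> by blast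
    then show False using no[of "comp u"] u sub by blast
  qed
  moreover have "ends G e \<subseteq> \<Union>(comp ` verts G)" using sub mem_comp by blast
  ultimately show "e \<in> {e \<in> F. ends G e \<subseteq> \<Union>(comp ` verts G) \<and> \<not> (\<exists>X\<in>comp ` verts G. ends G e \<subseteq> X)}"
    using no by blast
next
  fix e assume "e \<in> {e \<in> F. ends G e \<subseteq> \<Union>(comp ` verts G) \<and> \<not> (\<exists>X\<in>comp ` verts G. ends G e \<subseteq> X)}"
  then have e: "e \<in> F" and no: "\<And>X. X \<in> comp ` verts G \<Longrightarrow> \<not> ends G e \<subseteq> X" by blast+
  have "card (ends G e) = 2" "ends G e \<subseteq> verts G" using e F_graph by (simp_all add: graph_on_def)
  then obtain x y where xy: "ends G e = {x, y}" "x \<in> verts G" "y \<in> verts G" by (auto simp: card_2_iff)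
  have "comp x \<noteq> comp y" using no[of "comp x"] xy mem_comp by auto
  moreover have "ends G e \<inter> comp x \<noteq> {}" "ends G e \<inter> comp y \<noteq> {}"
    using xy mem_comp[OF xy(2)] mem_comp[OF xy(3)] by blast+
  ultimately show "e \<in> crossing_edges G (comp ` verts G)"
    using e F_edges xy(2,3) unfolding crossing_edges_def by blast
qed

text \<open>Each component \<open>X\<close> contains \<open>2 * card X - 2\<close> edges of
  \<open>F\<close>, and the other edges of \<open>F\<close> are the crossing ones. In
  \<open>2 * card Q\<close> minus the number of crossing edges the partition therefore cancels
  out.\<close>

lemma Omega_eq: "Omega 2 G = 2 * int (card (verts G)) - int (card F)"
proof -
  let ?Q = "comp ` verts G"
  have disj: "pairwise disjnt ?Q" by (rule disjoint_comps[OF order_refl])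
  have finQ: "finite ?Q" using finite_verts by simp
  have UQ: "\<Union>?Q = verts G" using mem_comp comp_subset by blast
  have "card F = (\<Sum>X\<in>?Q. card (inside (ends G) F X)) + card (crossing_edges G ?Q)"
    using card_inside_Union[of ?Q F "ends G", OF finQ disj finite_F graph_on_nonempty[OF F_graph]]
    unfolding crossing_edges_eq UQ inside_all[OF F_graph] .
  moreover have "(\<Sum>X\<in>?Q. card (inside (ends G) F X)) + 2 * card ?Q = 2 * card (verts G)"
    using sum_inside_comps[OF order_refl] unfolding UQ .
  ultimately show ?thesis unfolding Omega_def tree_components_eq by linarith
qed

end

section \<open>Counting at a barrier\<close>

text \<open>Edge by edge: the number of ends in \<open>S\<close>, plus one if there is none, equals
  one, plus one more if both ends are in \<open>S\<close>.\<close>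

lemma sum_degree_inside:
  assumes F: "graph_on \<phi> V F" and S: "S \<subseteq> V"
  shows "(\<Sum>v\<in>S. degree \<phi> F v) + card (inside \<phi> F (V - S)) = card F + card (inside \<phi> F S)"
proof -
  have fin: "finite F" "finite S" using F S by (auto simp: graph_on_def intro: finite_subset)
  have ind: "card (inside \<phi> F X) = (\<Sum>e\<in>F. of_bool (\<phi> e \<subseteq> X))" for X
    using fin(1) by (simp add: inside_def Int_def)
  have "card (\<phi> e \<inter> S) + of_bool (\<phi> e \<subseteq> V - S) = 1 + of_bool (\<phi> e \<subseteq> S)" if "e \<in> F" for e
  proof -
    have "card (\<phi> e) = 2" "\<phi> e \<subseteq> V" using that F by (simp_all add: graph_on_def)
    then obtain x y where "\<phi> e = {x, y}" "x \<noteq> y" "x \<in> V" "y \<in> V" by (auto simp: card_2_iff)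
    then show ?thesis by (cases "x \<in> S"; cases "y \<in> S") auto
  qed
  then have "(\<Sum>e\<in>F. card (\<phi> e \<inter> S) + of_bool (\<phi> e \<subseteq> V - S)) = (\<Sum>e\<in>F. 1 + of_bool (\<phi> e \<subseteq> S))"
    by (rule sum.cong[OF refl])
  then show ?thesis
    unfolding ind sum_degree[OF fin] by (simp only: sum.distrib card_eq_sum)
qed

theorem theorem1p6:
  fixes G :: "('v, 'e) multigraph" and f :: "'v \<Rightarrow> nat"
  assumes "fin_multigraph G"
    and "tree_connected 2 G"
    and "\<forall>v\<in>verts G. f v > 0"
    and "\<forall>S. S \<subseteq> verts G \<longrightarrow>
      1 / 2 * real_of_int (Omega 2 (del_verts G S)) \<le> (\<Sum>v\<in>S. (real (f v) - 3 / 2)) + 2"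
  shows "\<exists>vs es. closed_trail G vs es \<and> set vs = verts G \<and> (\<forall>v\<in>verts G. visits vs v \<le> f v)"
proof -
  let ?\<phi> = "ends G" and ?V = "verts G"
  have G: "graph_on ?\<phi> ?V (edges G)"
    using assms(1) by (simp add: graph_on_def fin_multigraph_def)
  obtain F0 where F0: "F0 \<subseteq> edges G" "base 2 ?\<phi> ?V F0"
    using assms(2) tree_connected_2_iff[OF G] by blast
  \<comment> \<open>The largest degree bound under which \<open>visits_le\<close> still gives at
    most \<open>f v\<close> visits.\<close>
  let ?h = "\<lambda>v. 2 * f v + 1"
  have no_barrier: False
    if F: "F \<subseteq> edges G" "base 2 ?\<phi> ?V F" and S: "S \<subseteq> ?V"
      and ge: "\<forall>v\<in>S. ?h v \<le> degree ?\<phi> F v" and gt: "\<exists>v\<in>S. ?h v < degree ?\<phi> F v"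
      and cover: "\<forall>e\<in>edges G - F. ?\<phi> e \<subseteq> ?V - S \<longrightarrow> (\<exists>X\<subseteq>?V - S. tight 2 ?\<phi> F X \<and> ?\<phi> e \<subseteq> X)"
    for F S
  proof -
    let ?W = "?V - S"
    note F_graph = baseD(1)[OF F(2)]
    have finS: "finite S" using S G by (auto simp: graph_on_def intro: finite_subset)
    have ins: "inside ?\<phi> (inside ?\<phi> F ?W) X = inside ?\<phi> F X" if "X \<subseteq> ?W" for X
      using that by (auto simp: inside_def)
    have "covered_base (del_verts G S) (inside ?\<phi> F ?W)"
    proof
      show "graph_on (ends (del_verts G S)) (verts (del_verts G S)) (edges (del_verts G S))"
        unfolding del_verts_def by (rule graph_on_induced[OF G]) blast
      show "inside ?\<phi> F ?W \<subseteq> edges (del_verts G S)"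
        using F(1) by (auto simp: del_verts_def induced_def inside_def)
      show "sparse 2 (ends (del_verts G S)) (verts (del_verts G S)) (inside ?\<phi> F ?W)"
        using baseD(2)[OF F(2)] ins by (auto simp: del_verts_def induced_def sparse_def)
      fix e assume "e \<in> edges (del_verts G S) - inside ?\<phi> F ?W"
      then have "e \<in> edges G - F" "?\<phi> e \<subseteq> ?W" by (auto simp: del_verts_def induced_def inside_def)
      then have "\<exists>X\<subseteq>?W. tight 2 ?\<phi> F X \<and> ?\<phi> e \<subseteq> X" using cover by simp
      then obtain X where "X \<subseteq> ?W" "tight 2 ?\<phi> F X" "?\<phi> e \<subseteq> X" by (elim exE conjE)
      then show "\<exists>X\<subseteq>verts (del_verts G S).
          tight 2 (ends (del_verts G S)) (inside ?\<phi> F ?W) X \<and> ends (del_verts G S) e \<subseteq> X"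
        using ins by (intro exI[of _ X]) (simp add: del_verts_def induced_def tight_def)
    qed
    then have "Omega 2 (del_verts G S)
        = 2 * int (card (verts (del_verts G S))) - int (card (inside ?\<phi> F ?W))"
      by (rule covered_base.Omega_eq)
    moreover have "card (verts (del_verts G S)) + card S = card ?V"
      using S finS baseD(5)[OF F(2)] by (simp add: del_verts_def induced_def card_Diff_subset card_mono)
    moreover have "(\<Sum>v\<in>S. degree ?\<phi> F v) + card (inside ?\<phi> F ?W) = card F + card (inside ?\<phi> F S)"
      by (rule sum_degree_inside[OF F_graph S])
    moreover have "card F + 2 = 2 * card ?V"
      using baseD(3)[OF F(2)] inside_all[OF F_graph] by (simp add: tight_def)
    \<comment> \<open>The vertex with strict excess shows that \<open>S\<close> is nonempty, as the
      sparsity bound requires.\<close>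
    moreover have "card (inside ?\<phi> F S) + 2 \<le> 2 * card S"
      by (rule sparseD[OF baseD(2)[OF F(2)] S]) (use gt in blast)
    moreover have "(\<Sum>v\<in>S. ?h v) < (\<Sum>v\<in>S. degree ?\<phi> F v)"
      using ge gt by (intro sum_strict_mono_ex1[OF finS]) auto
    then have "2 * (\<Sum>v\<in>S. f v) + card S < (\<Sum>v\<in>S. degree ?\<phi> F v)"
      by (simp only: sum.distrib sum_distrib_left[symmetric] card_eq_sum)
    \<comment> \<open>The constant 5 collects 2 from the size of \<open>F\<close>, 2 from sparsity
      inside \<open>S\<close>, and 1 from the strict inequality. Half of it exceeds the 2 that the
      hypothesis allows.\<close>
    ultimately have "2 * int (\<Sum>v\<in>S. f v) + 5 - 3 * int (card S) \<le> Omega 2 (del_verts G S)"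
      by linarith
    then have "real_of_int (2 * int (\<Sum>v\<in>S. f v) + 5 - 3 * int (card S))
        \<le> real_of_int (Omega 2 (del_verts G S))"
      by (simp only: of_int_le_iff)
    then have "2 * real (\<Sum>v\<in>S. f v) + 5 - 3 * real (card S) \<le> real_of_int (Omega 2 (del_verts G S))"
      by simp
    moreover have "(\<Sum>v\<in>S. (real (f v) - 3 / 2)) = real (\<Sum>v\<in>S. f v) - 3 / 2 * real (card S)"
      by (simp add: sum_subtractf)
    ultimately show False using assms(4)[rule_format, OF S] by linarith
  qed
  from base_or_barrier[OF _ G F0(2,1), of ?h] no_barrier
  obtain F where F: "F \<subseteq> edges G" "base 2 ?\<phi> ?V F" "\<forall>v\<in>?V. degree ?\<phi> F v \<le> ?h v"
    by (metis zero_less_numeral)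
  obtain K where K: "K \<subseteq> F" "cut_connected ?\<phi> ?V K" "\<And>v. even (degree ?\<phi> K v)"
    using connected_even_subgraph[OF F(2)] by blast
  obtain vs es where t: "closed_trail G vs es" "set vs = ?V" "set es \<subseteq> K"
    using spanning_closed_trail[OF G _ K(2,3)] K(1) F(1) by blast
  have "visits vs v \<le> f v" if "v \<in> ?V" for v
  proof (rule visits_le[OF t(1)])
    show "card (?\<phi> e) = 2" if "e \<in> edges G" for e using that G by (simp add: graph_on_def)
    show "set es \<subseteq> F" using t(3) K(1) by blast
    show "finite F" using baseD(4)[OF F(2)] .
  qed (use F(3) assms(3) that in auto)
  then show ?thesis using t(1,2) by blast
qed

end
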